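(* Let $n\ge0$ and let $\nu$ be a Lévy measure on $\mathbb R$ for which there exist $c_+\ge0$, $c_-\ge0$ with $c_++c_->0$ and $\alpha\in(0,2)$ such that $$\lim_{\varepsilon\downarrow0}\varepsilon^{\alpha}\nu((\varepsilon,\infty))=c_+,\qquad \lim_{\varepsilon\downarrow0}\varepsilon^{\alpha}\nu((-\infty,-\varepsilon))=c_-.$$ Let $\mu^*$ be the probability measure on $[-1,1]$ with density $$\mu^*(x)=\frac{(2-\alpha)|x|^{1-\alpha}\bigl(c_+1_{0\le x\le1}+c_-1_{-1\le x\le0}\bigr)}{c_++c_-}.$$ Fix real numbers $x_0<x_1<\dots<x_n$, all nonzero, and $a_0^*,\dots,a_n^*>0$ such that $\bar\mu=\sum_{i=0}^na_i^*\delta_{x_i}$ is a probability measure with $\int_{\mathbb R}x^k\bar\mu(dx)=\int_{\mathbb R}x^k\mu^*(dx)$ for $1\le k\le n$. For $\varepsilon>0$ let $\nu_\varepsilon$ be the measure of the high-order scheme based on the points $\{x_i\}$ (defined in the context). Then there exists $\varepsilon_0>0$ such that for all $\varepsilon<\varepsilon_0$, $\nu_\varepsilon$ is a positive measure satisfying $$\int_{\mathbb R}x^k\,\nu(dx)=\int_{\mathbb R}x^k\,\nu_\varepsilon(dx)\qquad\text{for every }2\le k\le n+2\text{ with }\int_{\mathbb R}|x|^k\nu(dx)<\infty.$$ Moreover, there exist positive constants $C_1$ and $C_2$ such that $$\lambda_\varepsilon:=\nu_\varepsilon(\mathbb R)\sim C_1\varepsilon^{-\alpha},\qquad \int_{\mathbb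 R}|x|^{n+3}\,|d\nu-d\nu_\varepsilon|\lesssim C_2\,\varepsilon^{n+3-\alpha}\qquad\text{as }\varepsilon\to0.$$
   Context: A Lévy measure on $\mathbb R$ is a measure $\nu$ with $\nu(\{0\})=0$ and $\int(1\wedge x^2)\nu(dx)<\infty$. $f\sim g$ means $\lim f/g=1$, and $f\lesssim g$ means $\limsup f/g\le1$. $|d\nu-d\nu_\varepsilon|$ denotes integration against the total variation of $\nu-\nu_\varepsilon$. High-order scheme: given the points $x_0<\dots<x_n$, the coefficients $a_0^\varepsilon,\dots,a_n^\varepsilon$ are the solution of the linear system $$\sigma_\varepsilon^2\sum_{i=0}^na_i^\varepsilon x_i^k\varepsilon^k=\int_{|x|\le\varepsilon}x^{2+k}\,\nu(dx),\quad k=0,\dots,n,\qquad \sigma_\varepsilon^2=\int_{|x|\le\varepsilon}x^2\,\nu(dx),$$ and $$\nu_\varepsilon(dx)=\nu(dx)1_{|x|>\varepsilon}+\sigma_\varepsilon^2\sum_{i=0}^n\frac{a_i^\varepsilon\,\delta_{\varepsilon x_i}(dx)}{x_i^2\varepsilon^2}.$$ *)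

theory Defs
  imports "HOL-Probability.Probability" "HOL-Library.Landau_Symbols"
begin

definition levy_measure :: "real measure \<Rightarrow> bool" where
  "levy_measure \<nu> \<longleftrightarrow> sets \<nu> = sets borel \<and> emeasure \<nu> {0} = 0 \<and>
     (\<integral>\<^sup>+x. ennreal (min 1 (x\<^sup>2)) \<partial>\<nu>) < \<infinity>"

definition mu_star :: "real \<Rightarrow> real \<Rightarrow> real \<Rightarrow> real measure" where
  "mu_star \<alpha> cp cm = density lborel (\<lambda>x. ennreal
     ((2 - \<alpha>) * \<bar>x\<bar> powr (1 - \<alpha>) * (cp * indicator {0..1} x + cm * indicator {-1..0} x)
       / (cp + cm)))"

text \<open>The discrete measure \<open>a 0 \<delta>(x 0) + \<dots> + a n \<delta>(x n)\<close>, for nonnegative weights.\<close>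

definition discrete_measure :: "nat \<Rightarrow> (nat \<Rightarrow> real) \<Rightarrow> (nat \<Rightarrow> real) \<Rightarrow> real measure" where
  "discrete_measure n a x = distr (point_measure {..n} (\<lambda>i. ennreal (a i))) borel x"

definition sigma2 :: "real measure \<Rightarrow> real \<Rightarrow> real" where
  "sigma2 \<nu> \<epsilon> = (LINT x:{x. \<bar>x\<bar> \<le> \<epsilon>}|\<nu>. x\<^sup>2)"

definition solves_scheme_system ::
  "real measure \<Rightarrow> nat \<Rightarrow> (nat \<Rightarrow> real) \<Rightarrow> real \<Rightarrow> (nat \<Rightarrow> real) \<Rightarrow> bool" where
  "solves_scheme_system \<nu> n x \<epsilon> a \<longleftrightarrow>
     (\<forall>k\<le>n. sigma2 \<nu> \<epsilon> * (\<Sum>i\<le>n. a i * x i ^ k * \<epsilon> ^ k)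
        = (LINT y:{y. \<bar>y\<bar> \<le> \<epsilon>}|\<nu>. y ^ (2 + k)))"

text \<open>For distinct points and \<open>sigma2 \<nu> \<epsilon> > 0\<close> this is an invertible Vandermonde system in
  \<open>a 0, \<dots>, a n\<close>; setting the irrelevant values \<open>a i\<close>, \<open>i > n\<close>, to zero makes the solution
  unique as a function on the naturals.\<close>

definition scheme_coeff ::
  "real measure \<Rightarrow> nat \<Rightarrow> (nat \<Rightarrow> real) \<Rightarrow> real \<Rightarrow> nat \<Rightarrow> real" where
  "scheme_coeff \<nu> n x \<epsilon> = (THE a. solves_scheme_system \<nu> n x \<epsilon> a \<and> (\<forall>i>n. a i = 0))"

text \<open>The coefficients may be negative, so \<open>\<nu>\<^sub>\<epsilon>\<close> is a priori only a finite signed measure; it is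
  represented by its values on Borel sets. Note that a Levy measure is finite on
  \<open>{x. \<bar>x\<bar> > \<epsilon>}\<close> for \<open>\<epsilon> > 0\<close>, so the use of the real-valued \<open>measure\<close> loses nothing.\<close>

definition nu_eps ::
  "real measure \<Rightarrow> nat \<Rightarrow> (nat \<Rightarrow> real) \<Rightarrow> real \<Rightarrow> real set \<Rightarrow> real" where
  "nu_eps \<nu> n x \<epsilon> A = measure \<nu> (A \<inter> {y. \<bar>y\<bar> > \<epsilon>})
     + sigma2 \<nu> \<epsilon> * (\<Sum>i\<le>n. scheme_coeff \<nu> n x \<epsilon> i * indicator A (\<epsilon> * x i) / ((x i)\<^sup>2 * \<epsilon>\<^sup>2))"

definition positive_borel_measure :: "(real set \<Rightarrow> real) \<Rightarrow> bool" where
  "positive_borel_measure \<mu> \<longleftrightarrow> (\<forall>A\<in>sets borel. 0 \<le> \<mu> A) \<and>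
     measure_space UNIV (sets borel) (\<lambda>A. ennreal (\<mu> A))"

definition to_measure :: "(real set \<Rightarrow> real) \<Rightarrow> real measure" where
  "to_measure \<mu> = measure_of UNIV (sets borel) (\<lambda>A. ennreal (\<mu> A))"

text \<open>The total variation of an extended-real-valued signed Borel measure: the supremum over
  finite measurable partitions.\<close>

definition total_variation :: "(real set \<Rightarrow> ereal) \<Rightarrow> real set \<Rightarrow> ennreal" where
  "total_variation \<mu> A =
     (SUP P\<in>{P. finite P \<and> disjoint P \<and> P \<subseteq> sets borel \<and> \<Union>P = A}. \<Sum>B\<in>P. e2ennreal \<bar>\<mu> B\<bar>)"

definition tv_measure :: "(real set \<Rightarrow> ereal) \<Rightarrow> real measure" where
  "tv_measure \<mu> = measure_of UNIV (sets borel) (total_variation \<mu>)"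

text \<open>The signed measure \<open>\<nu> - \<nu>\<^sub>\<epsilon>\<close>; it takes values in \<open>(-\<infinity>, \<infinity>]\<close> because \<open>\<nu>\<^sub>\<epsilon>\<close> is finite.\<close>

definition nu_diff ::
  "real measure \<Rightarrow> nat \<Rightarrow> (nat \<Rightarrow> real) \<Rightarrow> real \<Rightarrow> real set \<Rightarrow> ereal" where
  "nu_diff \<nu> n x \<epsilon> A = enn2ereal (emeasure \<nu> A) - ereal (nu_eps \<nu> n x \<epsilon> A)"

end

theory Submission
  imports Defs
begin

text \<open>
  The coefficients of the scheme solve a Vandermonde system whose right-hand sides are
  determined by truncated moments of \<open>\<nu>\<close>, and the key is how these behave near the origin. Writing
  \<open>(min y \<epsilon>)\<^sup>k\<close> as an integral of \<open>k t\<^sup>k\<^sup>-\<^sup>1\<close> and exchanging integrals turns the hypotheses on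
  the tails into the asymptotics of the truncated moments (\<open>truncated_moment_tendsto\<close>):
  \<open>\<integral>\<^bsub>\<bar>y\<bar> \<le> \<epsilon>\<^esub> y\<^sup>k d\<nu>\<close> is \<open>\<epsilon>\<^sup>k\<^sup>-\<^sup>\<alpha>\<close> times a quantity tending to
  \<open>(cp + (-1)\<^sup>k cm) \<alpha> / (k - \<alpha>)\<close>. In particular \<open>sigma2\<close> is of order \<open>\<epsilon>\<^sup>2\<^sup>-\<^sup>\<alpha>\<close>, and the
  normalised truncated moments converge to the moments of \<open>\<mu>\<^sup>*\<close>.

  The Vandermonde system is inverted by the Lagrange basis polynomials
  (\<open>vandermonde_system_iff\<close>): each unknown is a fixed linear combination of the right-hand sides.
  The right-hand sides converge to the moments of \<open>\<mu>\<^sup>*\<close>, which by hypothesis are those of the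
  quadrature rule with weights \<open>a i\<close> at the points \<open>x i\<close>. So the coefficients of the scheme
  converge to the \<open>a i\<close>, and they are positive for small \<open>\<epsilon>\<close> because the limits are.

  All claims follow. Positive coefficients make \<open>\<nu>\<^sub>\<epsilon>\<close> a measure, and the equations of the linear
  system say that its atoms have the same moments of order \<open>2\<close> to \<open>n + 2\<close> as the part of \<open>\<nu>\<close> that
  they replace (\<open>scheme_measure_moments\<close>). The total mass is the sum of the two tails, each of order
  at most \<open>\<epsilon>\<^sup>-\<^sup>\<alpha>\<close> by hypothesis, and of \<open>sigma2 / \<epsilon>\<^sup>2\<close> times a convergent factor. Finally, the total
  variation of \<open>\<nu> - \<nu>\<^sub>\<epsilon>\<close> is at most the removed part of \<open>\<nu>\<close> plus the atoms, all at distance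
  \<open>O(\<epsilon>)\<close> from the origin, so its absolute moment of order \<open>n + 3\<close> is \<open>O(\<epsilon>\<^sup>n\<^sup>+\<^sup>1 sigma2)\<close>
  (\<open>nn_integral_tv_nu_diff_le\<close>).
\<close>

section \<open>The layer-cake formula for truncated powers\<close>

lemma nn_integral_powr_from_0:
  fixes a c :: real
  assumes "a > -1" and "c \<ge> 0"
  shows "(\<integral>\<^sup>+t. ennreal (t powr a) * indicator {0..c} t \<partial>lborel) = ennreal (c powr (a + 1) / (a + 1))"
  by (intro nn_integral_has_integral_lebesgue' has_integral_powr_from_0 assms) auto

text \<open>For \<open>y > 0\<close> the number \<open>(min y \<epsilon>)\<^sup>p\<close> is the integral of \<open>p t\<^sup>p\<^sup>-\<^sup>1\<close> over the \<open>t\<close> in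
  \<open>[0, \<epsilon>]\<close> with \<open>t < y\<close>; exchanging the two integrals leaves the tail function of \<open>M\<close>. Truncating
  \<open>y\<close> at \<open>\<epsilon>\<close>, rather than cutting off the integral there, keeps the tail \<open>M (t, \<infinity>)\<close> itself
  instead of \<open>M (t, \<epsilon>]\<close>.\<close>

lemma layer_cake_truncated_powr:
  fixes M :: "real measure" and p \<epsilon> :: real
  assumes "sigma_finite_measure M" and sets_M: "sets M = sets borel" and "p > 0" and "\<epsilon> > 0"
  shows "(\<integral>\<^sup>+y. ennreal (min y \<epsilon> powr p) * indicator {0<..} y \<partial>M)
       = (\<integral>\<^sup>+t. ennreal (p * t powr (p - 1)) * indicator {0..\<epsilon>} t * emeasure M {t<..} \<partial>lborel)"
proof -
  interpret sigma_finite_measure M by fact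
  interpret pair_sigma_finite M lborel ..
  note [measurable_cong] = sets_M
  let ?g = "\<lambda>t. ennreal (p * t powr (p - 1)) * indicator {0..\<epsilon>} t"
  have inner: "ennreal (min y \<epsilon> powr p) * indicator {0<..} y
      = (\<integral>\<^sup>+t. ?g t * indicator {..<y} t \<partial>lborel)" for y
  proof (cases "y > 0")
    case True
    have "(\<integral>\<^sup>+t. ?g t * indicator {..<y} t \<partial>lborel)
        = (\<integral>\<^sup>+t. ennreal p * (ennreal (t powr (p - 1)) * indicator {0..min y \<epsilon>} t) \<partial>lborel)"
      \<comment> \<open>\<open>{..<y}\<close> and \<open>{..y}\<close> differ by a Lebesgue null set.\<close>
      by (rule nn_integral_cong_AE, use AE_lborel_singleton[of y] in eventually_elim)
         (use \<open>p > 0\<close> in \<open>auto simp: indicator_def ennreal_mult\<close>)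
    also have "\<dots> = ennreal p * ennreal (min y \<epsilon> powr p / p)"
      using nn_integral_powr_from_0[of "p - 1" "min y \<epsilon>"] assms True
      by (subst nn_integral_cmult) auto
    also have "\<dots> = ennreal (min y \<epsilon> powr p)"
      using \<open>p > 0\<close> by (simp flip: ennreal_mult')
    finally show ?thesis using True by simp
  next
    case False
    have "(\<integral>\<^sup>+t. ?g t * indicator {..<y} t \<partial>lborel) = (\<integral>\<^sup>+(t::real). 0 \<partial>lborel)"
      using False by (intro nn_integral_cong) (auto simp: indicator_def)
    then show ?thesis using False by simp
  qed
  have "(\<integral>\<^sup>+y. ennreal (min y \<epsilon> powr p) * indicator {0<..} y \<partial>M)
      = (\<integral>\<^sup>+y. \<integral>\<^sup>+t. ?g t * (if t < y then 1 else 0) \<partial>lborel \<partial>M)"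
    unfolding inner by (intro nn_integral_cong) (auto simp: indicator_def)
  also have "\<dots> = (\<integral>\<^sup>+t. \<integral>\<^sup>+y. ?g t * (if t < y then 1 else 0) \<partial>M \<partial>lborel)"
    by (rule Fubini'[symmetric]) measurable
  also have "\<dots> = (\<integral>\<^sup>+t. ?g t * emeasure M {t<..} \<partial>lborel)"
  proof (intro nn_integral_cong)
    fix t :: real
    have "(\<integral>\<^sup>+y. ?g t * (if t < y then 1 else 0) \<partial>M)
        = (\<integral>\<^sup>+y. ?g t * indicator {t<..} y \<partial>M)"
      by (intro nn_integral_cong) (auto simp: indicator_def)
    also have "\<dots> = ?g t * emeasure M {t<..}"
      by (subst nn_integral_cmult_indicator) (simp_all add: sets_M)
    finally show "(\<integral>\<^sup>+y. ?g t * (if t < y then 1 else 0) \<partial>M) = ?g t * emeasure M {t<..}" .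
  qed
  finally show ?thesis .
qed

section \<open>Integrability with respect to a Levy measure\<close>

lemma levy_measure_finite_away_from_0:
  assumes "levy_measure \<nu>" and "\<epsilon> > 0"
  shows "emeasure \<nu> {y. \<epsilon> < \<bar>y\<bar>} < \<infinity>"
proof -
  have [measurable_cong, simp]: "sets \<nu> = sets borel" using assms by (simp add: levy_measure_def)
  have eps: "min 1 (\<epsilon>\<^sup>2) > 0" using \<open>\<epsilon> > 0\<close> by simp
  have "ennreal (min 1 (\<epsilon>\<^sup>2)) * emeasure \<nu> {y. \<epsilon> < \<bar>y\<bar>}
      = (\<integral>\<^sup>+y. ennreal (min 1 (\<epsilon>\<^sup>2)) * indicator {y. \<epsilon> < \<bar>y\<bar>} y \<partial>\<nu>)"
    by (subst nn_integral_cmult_indicator) simp_all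
  also have "\<dots> \<le> (\<integral>\<^sup>+y. ennreal (min 1 (y\<^sup>2)) \<partial>\<nu>)"
  proof (intro nn_integral_mono)
    fix y :: real
    have "\<epsilon>\<^sup>2 \<le> y\<^sup>2" if "\<epsilon> < \<bar>y\<bar>"
      using that \<open>\<epsilon> > 0\<close> by (simp add: abs_le_square_iff[symmetric])
    then show "ennreal (min 1 (\<epsilon>\<^sup>2)) * indicator {y. \<epsilon> < \<bar>y\<bar>} y \<le> ennreal (min 1 (y\<^sup>2))"
      by (auto simp: indicator_def intro!: ennreal_leI)
  qed
  also have "\<dots> < \<infinity>" using assms by (simp add: levy_measure_def)
  finally show ?thesis using eps by (auto simp: ennreal_mult_less_top less_top)
qed

lemma levy_measure_emeasure_away_from_0:
  assumes "levy_measure \<nu>" and "\<epsilon> > 0" and "A \<subseteq> {y. \<epsilon> < \<bar>y\<bar>}"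
  shows "emeasure \<nu> A = ennreal (measure \<nu> A)"
proof -
  have "emeasure \<nu> A \<le> emeasure \<nu> {y. \<epsilon> < \<bar>y\<bar>}"
    using assms by (intro emeasure_mono) (auto simp: levy_measure_def)
  also have "\<dots> < \<infinity>" using assms by (intro levy_measure_finite_away_from_0)
  finally show ?thesis by (intro emeasure_eq_ennreal_measure) simp
qed

text \<open>This is what licenses the use of Fubini's theorem in the layer-cake formula.\<close>

lemma levy_measure_sigma_finite:
  assumes "levy_measure \<nu>"
  shows "sigma_finite_measure \<nu>"
proof
  have s: "sets \<nu> = sets borel" and z: "emeasure \<nu> {0} = 0"
    using assms by (simp_all add: levy_measure_def)
  have sp: "space \<nu> = UNIV" using sets_eq_imp_space_eq[OF s] by simp
  let ?A = "insert {0} (range (\<lambda>n. {y::real. 1 / Suc n < \<bar>y\<bar>}))"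
  have "y \<in> \<Union>?A" for y
  proof (cases "y = 0")
    case False
    then obtain n where "1 / Suc n < \<bar>y\<bar>" using nat_approx_posE[of "\<bar>y\<bar>"] by auto
    then show ?thesis by auto
  qed simp
  then have "\<Union>?A = UNIV" by blast
  moreover have "emeasure \<nu> {y. 1 / Suc n < \<bar>y\<bar>} \<noteq> \<infinity>" for n
    using levy_measure_finite_away_from_0[OF assms, of "1 / Suc n"] by simp
  ultimately show "\<exists>A. countable A \<and> A \<subseteq> sets \<nu> \<and> \<Union>A = space \<nu> \<and> (\<forall>a\<in>A. emeasure \<nu> a \<noteq> \<infinity>)"
    by (intro exI[of _ ?A]) (auto simp: s sp z)
qed

text \<open>Near the origin \<open>\<bar>y\<bar>\<^sup>k \<le> y\<^sup>2\<close>, and where \<open>1 < \<bar>y\<bar> \<le> \<epsilon>\<close> it is at most \<open>\<epsilon>\<^sup>k\<close>; either way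
  it is dominated by a multiple of \<open>min 1 y\<^sup>2\<close>.\<close>

lemma levy_measure_power_integrable:
  assumes "levy_measure \<nu>" and "k \<ge> 2"
  shows "set_integrable \<nu> {y. \<bar>y\<bar> \<le> \<epsilon>} (\<lambda>y. y ^ k)"
proof -
  have [measurable_cong, simp]: "sets \<nu> = sets borel" using assms by (simp add: levy_measure_def)
  have "integrable \<nu> (\<lambda>y. min 1 (y\<^sup>2))"
    using assms by (intro integrableI_bounded) (auto simp: levy_measure_def)
  then have int: "integrable \<nu> (\<lambda>y. (1 + \<epsilon> ^ k) * min 1 (y\<^sup>2))" by simp
  show ?thesis unfolding set_integrable_def
  proof (rule Bochner_Integration.integrable_bound[OF int], measurable, intro AE_I2)
    fix y :: real
    have "\<bar>y\<bar> ^ k \<le> (1 + \<epsilon> ^ k) * min 1 (y\<^sup>2)" if "\<bar>y\<bar> \<le> \<epsilon>"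
    proof (cases "\<bar>y\<bar> \<le> 1")
      case True
      have "\<bar>y\<bar> ^ k \<le> 1 * y\<^sup>2" using power_decreasing[of 2 k "\<bar>y\<bar>"] True \<open>k \<ge> 2\<close> by simp
      also have "\<dots> \<le> (1 + \<epsilon> ^ k) * y\<^sup>2" using that by (intro mult_right_mono) auto
      finally show ?thesis using True by (simp add: min_absorb2 abs_square_le_1)
    next
      case False
      then have "1 < y\<^sup>2" by (metis linorder_not_le abs_square_le_1)
      moreover have "\<bar>y\<bar> ^ k \<le> \<epsilon> ^ k" using that by (intro power_mono) auto
      ultimately show ?thesis by simp
    qed
    then show "norm (indicat_real {y. \<bar>y\<bar> \<le> \<epsilon>} y *\<^sub>R y ^ k) \<le> norm ((1 + \<epsilon> ^ k) * min 1 (y\<^sup>2))"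
      by (auto simp: indicator_def power_abs)
  qed
qed

section \<open>Asymptotics of truncated moments\<close>

text \<open>Two-sided bounds on the tail by multiples of \<open>t\<^sup>-\<^sup>\<alpha>\<close> pass through the layer-cake integral, where
  \<open>p t\<^sup>p\<^sup>-\<^sup>1\<^sup>-\<^sup>\<alpha>\<close> is integrable at 0 because \<open>\<alpha> < p\<close>.\<close>

lemma tail_bounds_imp_truncated_moment_bounds:
  fixes M :: "real measure" and p \<epsilon> \<alpha> U L :: real
  assumes "sigma_finite_measure M" and "sets M = sets borel"
    and "0 < \<epsilon>" and "0 < \<alpha>" and "\<alpha> < p" and "0 \<le> L" and "0 \<le> U"
    and tail: "\<And>t. 0 < t \<Longrightarrow> t \<le> \<epsilon> \<Longrightarrow> emeasure M {t<..} \<in> {ennreal (L * t powr - \<alpha>)..ennreal (U * t powr - \<alpha>)}"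
  shows "(\<integral>\<^sup>+y. ennreal (min y \<epsilon> powr p) * indicator {0<..} y \<partial>M)
    \<in> {ennreal (L * p / (p - \<alpha>) * \<epsilon> powr (p - \<alpha>))..ennreal (U * p / (p - \<alpha>) * \<epsilon> powr (p - \<alpha>))}"
proof -
  let ?I = "\<integral>\<^sup>+t. ennreal (p * t powr (p - 1)) * indicator {0..\<epsilon>} t * emeasure M {t<..} \<partial>lborel"
  have power_integral: "(\<integral>\<^sup>+t. ennreal (p * t powr (p - 1)) * indicator {0..\<epsilon>} t * ennreal (C * t powr - \<alpha>) \<partial>lborel)
      = ennreal (C * p / (p - \<alpha>) * \<epsilon> powr (p - \<alpha>))" if "0 \<le> C" for C
  proof -
    have "ennreal (p * t powr (p - 1)) * indicator {0..\<epsilon>} t * ennreal (C * t powr - \<alpha>)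
        = ennreal (C * p) * (ennreal (t powr (p - \<alpha> - 1)) * indicator {0..\<epsilon>} t)" for t
      using that assms by (auto simp: indicator_def ennreal_mult'[symmetric] powr_add[symmetric] algebra_simps)
    then have "(\<integral>\<^sup>+t. ennreal (p * t powr (p - 1)) * indicator {0..\<epsilon>} t * ennreal (C * t powr - \<alpha>) \<partial>lborel)
        = ennreal (C * p) * ennreal (\<epsilon> powr (p - \<alpha>) / (p - \<alpha>))"
      using nn_integral_powr_from_0[of "p - \<alpha> - 1" \<epsilon>] assms by (simp add: nn_integral_cmult)
    then show ?thesis using that assms by (simp flip: ennreal_mult')
  qed
  have "?I \<ge> ennreal (L * p / (p - \<alpha>) * \<epsilon> powr (p - \<alpha>))"
    unfolding power_integral[OF \<open>0 \<le> L\<close>, symmetric]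
  proof (intro nn_integral_mono)
    fix t :: real
    show "ennreal (p * t powr (p - 1)) * indicator {0..\<epsilon>} t * ennreal (L * t powr - \<alpha>)
      \<le> ennreal (p * t powr (p - 1)) * indicator {0..\<epsilon>} t * emeasure M {t<..}"
      using tail[of t] by (cases "t = 0") (auto simp: indicator_def intro!: mult_left_mono)
  qed
  moreover have "?I \<le> ennreal (U * p / (p - \<alpha>) * \<epsilon> powr (p - \<alpha>))"
    unfolding power_integral[OF \<open>0 \<le> U\<close>, symmetric]
  proof (intro nn_integral_mono)
    fix t :: real
    show "ennreal (p * t powr (p - 1)) * indicator {0..\<epsilon>} t * emeasure M {t<..}
      \<le> ennreal (p * t powr (p - 1)) * indicator {0..\<epsilon>} t * ennreal (U * t powr - \<alpha>)"
      using tail[of t] by (cases "t = 0") (auto simp: indicator_def intro!: mult_left_mono)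
  qed
  ultimately show ?thesis
    using layer_cake_truncated_powr[of M p \<epsilon>] assms by simp
qed

lemma truncated_power_split:
  assumes "levy_measure \<nu>" and "k \<ge> 2" and "\<epsilon> > 0"
  shows "(\<integral>\<^sup>+y. ennreal (min y \<epsilon> powr real k) * indicator {0<..} y \<partial>\<nu>)
     = ennreal ((LINT y:{0<..\<epsilon>}|\<nu>. y ^ k) + \<epsilon> ^ k * measure \<nu> {\<epsilon><..})"
proof -
  have [measurable_cong, simp]: "sets \<nu> = sets borel" using assms by (simp add: levy_measure_def)
  have int: "set_integrable \<nu> {0<..\<epsilon>} (\<lambda>y. y ^ k)"
    by (rule set_integrable_subset[OF levy_measure_power_integrable[OF assms(1,2), of \<epsilon>]]) auto
  have fin: "emeasure \<nu> {\<epsilon><..} = ennreal (measure \<nu> {\<epsilon><..})"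
    using assms by (intro levy_measure_emeasure_away_from_0[of _ \<epsilon>]) auto
  have "(\<integral>\<^sup>+y. ennreal (min y \<epsilon> powr real k) * indicator {0<..} y \<partial>\<nu>)
      = (\<integral>\<^sup>+y. ennreal (indicator {0<..\<epsilon>} y * y ^ k) + ennreal (\<epsilon> ^ k) * indicator {\<epsilon><..} y \<partial>\<nu>)"
    using \<open>\<epsilon> > 0\<close> by (intro nn_integral_cong) (auto simp: indicator_def powr_realpow min_def)
  also have "\<dots> = (\<integral>\<^sup>+y. ennreal (indicator {0<..\<epsilon>} y * y ^ k) \<partial>\<nu>)
      + ennreal (\<epsilon> ^ k) * emeasure \<nu> {\<epsilon><..}"
    by (subst nn_integral_add) (auto simp: nn_integral_cmult_indicator)
  also have "(\<integral>\<^sup>+y. ennreal (indicator {0<..\<epsilon>} y * y ^ k) \<partial>\<nu>) = ennreal (LINT y:{0<..\<epsilon>}|\<nu>. y ^ k)"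
    using int unfolding set_lebesgue_integral_def set_integrable_def real_scaleR_def
    by (intro nn_integral_eq_integral) (auto simp: indicator_def)
  moreover have "0 \<le> (LINT y:{0<..\<epsilon>}|\<nu>. y ^ k)"
    unfolding set_lebesgue_integral_def by (intro integral_nonneg_AE) (auto simp: indicator_def)
  ultimately show ?thesis
    unfolding fin using \<open>\<epsilon> > 0\<close> by (simp add: ennreal_mult')
qed

text \<open>If the tail is exactly \<open>c t\<^sup>-\<^sup>\<alpha>\<close>, the layer-cake formula gives
  \<open>\<integral> (min y \<epsilon>)\<^sup>k = c k / (k - \<alpha>) \<epsilon>\<^sup>k\<^sup>-\<^sup>\<alpha>\<close>. The part of this integral beyond \<open>\<epsilon>\<close> is
  \<open>\<epsilon>\<^sup>k \<nu> (\<epsilon>, \<infinity>) = c \<epsilon>\<^sup>k\<^sup>-\<^sup>\<alpha>\<close>, and \<open>c k / (k - \<alpha>) - c = c \<alpha> / (k - \<alpha>)\<close>.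
  The hypothesis traps the tail between two such functions with constants close to \<open>c\<close>.\<close>

lemma truncated_moment_tendsto_right:
  assumes "levy_measure \<nu>" and "k \<ge> 2" and "0 < \<alpha>" and "\<alpha> < 2" and "0 \<le> c"
    and tail: "((\<lambda>\<epsilon>. \<epsilon> powr \<alpha> * measure \<nu> {\<epsilon><..}) \<longlongrightarrow> c) (at_right 0)"
  shows "((\<lambda>\<epsilon>. \<epsilon> powr (\<alpha> - real k) * (LINT y:{0<..\<epsilon>}|\<nu>. y ^ k)) \<longlongrightarrow> c * \<alpha> / (real k - \<alpha>)) (at_right 0)"
proof -
  \<comment> \<open>The integral of \<open>(min y \<epsilon>)\<^sup>k\<close> over the positive half-line, as a real number.\<close>
  define J where "J \<epsilon> = (LINT y:{0<..\<epsilon>}|\<nu>. y ^ k) + \<epsilon> ^ k * measure \<nu> {\<epsilon><..}" for \<epsilon>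
  have ka: "\<alpha> < real k" using assms by linarith
  have s: "sets \<nu> = sets borel" using assms by (simp add: levy_measure_def)
  have J0: "0 \<le> J \<epsilon>" if "\<epsilon> > 0" for \<epsilon>
  proof -
    have "0 \<le> (LINT y:{0<..\<epsilon>}|\<nu>. y ^ k)"
      unfolding set_lebesgue_integral_def by (intro integral_nonneg_AE) (auto simp: indicator_def)
    then show ?thesis using that by (simp add: J_def)
  qed
  have "((\<lambda>\<epsilon>. \<epsilon> powr (\<alpha> - real k) * J \<epsilon>) \<longlongrightarrow> c * k / (real k - \<alpha>)) (at_right 0)"
  proof (rule tendstoI)
    fix e :: real assume "e > 0"
    define \<delta> where "\<delta> = e * (real k - \<alpha>) / k / 2"
    have "\<delta> > 0" using \<open>e > 0\<close> ka \<open>k \<ge> 2\<close> by (simp add: \<delta>_def)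
    have "\<delta> * k / (real k - \<alpha>) = e / 2" using ka \<open>k \<ge> 2\<close> by (simp add: \<delta>_def field_simps)
    then have small: "\<delta> * k / (real k - \<alpha>) < e" using \<open>e > 0\<close> by simp
    obtain b where "b > 0" and b: "\<And>t. 0 < t \<Longrightarrow> t < b \<Longrightarrow> \<bar>t powr \<alpha> * measure \<nu> {t<..} - c\<bar> < \<delta>"
      using tendstoD[OF tail \<open>\<delta> > 0\<close>] by (auto simp: eventually_at_right_field dist_real_def)
    have "dist (\<epsilon> powr (\<alpha> - real k) * J \<epsilon>) (c * k / (real k - \<alpha>)) < e" if "0 < \<epsilon>" "\<epsilon> < b" for \<epsilon>
    proof -
      \<comment> \<open>Clipping at 0 keeps the lower bound nonnegative when \<open>c < \<delta>\<close>, in particular when \<open>c = 0\<close>.\<close>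
      let ?L = "max 0 (c - \<delta>)" and ?U = "c + \<delta>"
      have "emeasure \<nu> {t<..} \<in> {ennreal (?L * t powr - \<alpha>)..ennreal (?U * t powr - \<alpha>)}"
        if "0 < t" "t \<le> \<epsilon>" for t
      proof -
        have fin: "emeasure \<nu> {t<..} = ennreal (measure \<nu> {t<..})"
          using assms \<open>0 < t\<close> by (intro levy_measure_emeasure_away_from_0[of _ t]) auto
        have "\<bar>t powr \<alpha> * measure \<nu> {t<..} - c\<bar> < \<delta>" using b that \<open>\<epsilon> < b\<close> by simp
        moreover have "0 \<le> t powr \<alpha> * measure \<nu> {t<..}" by simp
        ultimately have "?L \<le> t powr \<alpha> * measure \<nu> {t<..}" "t powr \<alpha> * measure \<nu> {t<..} \<le> ?U"
          by linarith+
        then show ?thesis unfolding fin using \<open>0 < t\<close>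
          by (auto intro!: ennreal_leI simp: powr_minus field_simps)
      qed
      then have "(\<integral>\<^sup>+y. ennreal (min y \<epsilon> powr k) * indicator {0<..} y \<partial>\<nu>)
        \<in> {ennreal (?L * k / (real k - \<alpha>) * \<epsilon> powr (real k - \<alpha>))..ennreal (?U * k / (real k - \<alpha>) * \<epsilon> powr (real k - \<alpha>))}"
        using \<open>0 < \<epsilon>\<close> \<open>0 < \<alpha>\<close> ka \<open>\<delta> > 0\<close> \<open>0 \<le> c\<close>
        by (intro tail_bounds_imp_truncated_moment_bounds levy_measure_sigma_finite assms s) auto
      then have "?L * k / (real k - \<alpha>) * \<epsilon> powr (real k - \<alpha>) \<le> J \<epsilon>"
        "J \<epsilon> \<le> ?U * k / (real k - \<alpha>) * \<epsilon> powr (real k - \<alpha>)"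
        unfolding truncated_power_split[OF assms(1,2) \<open>0 < \<epsilon>\<close>] J_def[symmetric]
        using J0[OF \<open>0 < \<epsilon>\<close>] \<open>\<delta> > 0\<close> \<open>0 \<le> c\<close> ka by auto
      from this[THEN mult_right_mono, of "\<epsilon> powr (\<alpha> - real k)"]
      have "?L * k / (real k - \<alpha>) \<le> J \<epsilon> * \<epsilon> powr (\<alpha> - real k)"
          "J \<epsilon> * \<epsilon> powr (\<alpha> - real k) \<le> ?U * k / (real k - \<alpha>)"
        using \<open>0 < \<epsilon>\<close> by (simp_all only: mult.assoc powr_add[symmetric]) (simp_all add: mult_ac)
      moreover have "c * k / (real k - \<alpha>) - \<delta> * k / (real k - \<alpha>) \<le> ?L * k / (real k - \<alpha>)"
        unfolding diff_divide_distrib[symmetric] left_diff_distrib[symmetric]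
        using ka by (intro divide_right_mono mult_right_mono) auto
      moreover have "?U * k / (real k - \<alpha>) = c * k / (real k - \<alpha>) + \<delta> * k / (real k - \<alpha>)"
        by (simp add: distrib_right add_divide_distrib)
      ultimately have "c * k / (real k - \<alpha>) - \<delta> * k / (real k - \<alpha>) \<le> J \<epsilon> * \<epsilon> powr (\<alpha> - real k)"
        "J \<epsilon> * \<epsilon> powr (\<alpha> - real k) \<le> c * k / (real k - \<alpha>) + \<delta> * k / (real k - \<alpha>)"
        by (metis order.trans, metis)
      then have "\<bar>J \<epsilon> * \<epsilon> powr (\<alpha> - real k) - c * k / (real k - \<alpha>)\<bar> \<le> \<delta> * k / (real k - \<alpha>)"
        unfolding abs_le_iff by (simp only: le_diff_eq diff_le_eq minus_diff_eq add.commute simp_thms)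
      with small show ?thesis unfolding dist_real_def by (simp only: mult.commute[of "J \<epsilon>"] le_less_trans)
    qed
    then show "\<forall>\<^sub>F \<epsilon> in at_right 0. dist (\<epsilon> powr (\<alpha> - real k) * J \<epsilon>) (c * k / (real k - \<alpha>)) < e"
      using \<open>b > 0\<close> by (auto simp: eventually_at_right_field)
  qed
  from tendsto_diff[OF this tail]
  have "((\<lambda>\<epsilon>. \<epsilon> powr (\<alpha> - real k) * J \<epsilon> - \<epsilon> powr \<alpha> * measure \<nu> {\<epsilon><..}) \<longlongrightarrow> c * k / (real k - \<alpha>) - c) (at_right 0)" .
  moreover have "c * k / (real k - \<alpha>) - c = c * \<alpha> / (real k - \<alpha>)"
    using ka by (simp add: field_simps)
  moreover have "\<forall>\<^sub>F \<epsilon> in at_right 0. \<epsilon> powr (\<alpha> - real k) * J \<epsilon> - \<epsilon> powr \<alpha> * measure \<nu> {\<epsilon><..}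
      = \<epsilon> powr (\<alpha> - real k) * (LINT y:{0<..\<epsilon>}|\<nu>. y ^ k)"
    unfolding eventually_at_right_field
  proof (intro exI[of _ 1] conjI allI impI)
    fix \<epsilon> :: real assume "0 < \<epsilon>"
    then have "\<epsilon> powr (\<alpha> - real k) * \<epsilon> ^ k = \<epsilon> powr \<alpha>"
      by (simp add: powr_realpow[symmetric] powr_add[symmetric])
    then show "\<epsilon> powr (\<alpha> - real k) * J \<epsilon> - \<epsilon> powr \<alpha> * measure \<nu> {\<epsilon><..}
      = \<epsilon> powr (\<alpha> - real k) * (LINT y:{0<..\<epsilon>}|\<nu>. y ^ k)"
      unfolding J_def distrib_left mult.assoc[symmetric] by simp
  qed simp
  ultimately show ?thesis by (simp add: tendsto_cong)
qed

lemma levy_measure_reflect: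
  assumes "levy_measure \<nu>"
  shows "levy_measure (distr \<nu> borel uminus)"
proof -
  have [measurable_cong, simp]: "sets \<nu> = sets borel" using assms by (simp add: levy_measure_def)
  have "space \<nu> = UNIV" using sets_eq_imp_space_eq[of \<nu> borel] by simp
  moreover have "uminus -` {0::real} = {0}" by auto
  ultimately show ?thesis using assms unfolding levy_measure_def
    by (auto simp: emeasure_distr nn_integral_distr)
qed

text \<open>The negative half-line contributes the same limit for the reflected measure, with the
  sign \<open>(-1)\<^sup>k\<close>.\<close>

lemma truncated_moment_tendsto:
  assumes levy: "levy_measure \<nu>" and "k \<ge> 2" and "0 < \<alpha>" and "\<alpha> < 2" and "0 \<le> cp" and "0 \<le> cm"
    and "((\<lambda>\<epsilon>. \<epsilon> powr \<alpha> * measure \<nu> {\<epsilon><..}) \<longlongrightarrow> cp) (at_right 0)"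
    and tail_left: "((\<lambda>\<epsilon>. \<epsilon> powr \<alpha> * measure \<nu> {..<-\<epsilon>}) \<longlongrightarrow> cm) (at_right 0)"
  shows "((\<lambda>\<epsilon>. \<epsilon> powr (\<alpha> - real k) * (LINT y:{y. \<bar>y\<bar> \<le> \<epsilon>}|\<nu>. y ^ k))
          \<longlongrightarrow> (cp + (- 1) ^ k * cm) * \<alpha> / (real k - \<alpha>)) (at_right 0)"
proof -
  have [measurable_cong, simp]: "sets \<nu> = sets borel" using assms by (simp add: levy_measure_def)
  have sp[simp]: "space \<nu> = UNIV" using sets_eq_imp_space_eq[of \<nu> borel] by simp
  let ?R = "distr \<nu> borel uminus"
  have "measure ?R {\<epsilon><..} = measure \<nu> {..<-\<epsilon>}" for \<epsilon>
    by (subst measure_distr) (auto intro!: arg_cong[where f = "measure \<nu>"])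
  with tail_left have "((\<lambda>\<epsilon>. \<epsilon> powr \<alpha> * measure ?R {\<epsilon><..}) \<longlongrightarrow> cm) (at_right 0)" by simp
  note left = truncated_moment_tendsto_right[OF levy_measure_reflect[OF levy] assms(2-4) \<open>0 \<le> cm\<close> this]
  have split: "(LINT y:{y. \<bar>y\<bar> \<le> \<epsilon>}|\<nu>. y ^ k)
      = (LINT y:{0<..\<epsilon>}|\<nu>. y ^ k) + (- 1) ^ k * (LINT y:{0<..\<epsilon>}|?R. y ^ k)" for \<epsilon>
  proof -
    have int: "set_integrable \<nu> {y. \<bar>y\<bar> \<le> \<epsilon>} (\<lambda>y. y ^ k)"
      by (rule levy_measure_power_integrable) fact+
    have "(LINT y:{0<..\<epsilon>}|?R. y ^ k) = (LINT y|\<nu>. indicator {0<..\<epsilon>} (- y) * (- y) ^ k)"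
      unfolding set_lebesgue_integral_def by (subst integral_distr) auto
    also have "\<dots> = (LINT y|\<nu>. (- 1) ^ k * (indicator {-\<epsilon>..<0} y * y ^ k))"
      by (intro Bochner_Integration.integral_cong) (auto simp: indicator_def power_minus')
    also have "\<dots> = (- 1) ^ k * (LINT y:{-\<epsilon>..<0}|\<nu>. y ^ k)"
      unfolding set_lebesgue_integral_def by simp
    finally have R: "(- 1) ^ k * (LINT y:{0<..\<epsilon>}|?R. y ^ k) = (LINT y:{-\<epsilon>..<0}|\<nu>. y ^ k)"
      by (simp add: power_mult_distrib[symmetric] flip: mult.assoc)
    have "(LINT y:{y. \<bar>y\<bar> \<le> \<epsilon>}|\<nu>. y ^ k) = (LINT y:{0<..\<epsilon>} \<union> {-\<epsilon>..<0}|\<nu>. y ^ k)"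
      unfolding set_lebesgue_integral_def
      by (intro Bochner_Integration.integral_cong) (use \<open>k \<ge> 2\<close> in \<open>auto simp: indicator_def\<close>)
    also have "\<dots> = (LINT y:{0<..\<epsilon>}|\<nu>. y ^ k) + (LINT y:{-\<epsilon>..<0}|\<nu>. y ^ k)"
      by (intro set_integral_Un set_integrable_subset[OF int]) auto
    finally show ?thesis by (simp add: R)
  qed
  have "((\<lambda>\<epsilon>. \<epsilon> powr (\<alpha> - real k) * (LINT y:{0<..\<epsilon>}|\<nu>. y ^ k)
      + (- 1) ^ k * (\<epsilon> powr (\<alpha> - real k) * (LINT y:{0<..\<epsilon>}|?R. y ^ k)))
      \<longlongrightarrow> cp * \<alpha> / (real k - \<alpha>) + (- 1) ^ k * (cm * \<alpha> / (real k - \<alpha>))) (at_right 0)"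
    by (intro tendsto_add tendsto_mult tendsto_const left
          truncated_moment_tendsto_right[OF levy assms(2-4) \<open>0 \<le> cp\<close> assms(7)])
  then show ?thesis unfolding split by (simp add: algebra_simps add_divide_distrib)
qed

section \<open>Inverting the Vandermonde system\<close>

definition lagrange_basis :: "nat \<Rightarrow> (nat \<Rightarrow> 'a::field) \<Rightarrow> nat \<Rightarrow> 'a poly" where
  "lagrange_basis n x i = (\<Prod>j\<in>{..n} - {i}. smult (1 / (x i - x j)) [:- x j, 1:])"

lemma poly_lagrange_basis:
  assumes "inj_on x {..n}" and "i \<le> n" and "j \<le> n"
  shows "poly (lagrange_basis n x i) (x j) = (if i = j then 1 else 0)"
proof (cases "i = j")
  case True
  then show ?thesis using assms
    by (auto simp: lagrange_basis_def poly_prod inj_on_eq_iff diff_divide_distrib[symmetric] intro!: prod.neutral)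
next
  case False
  then show ?thesis using assms
    by (auto simp: lagrange_basis_def poly_prod intro!: prod_zero bexI[of _ j])
qed

lemma degree_lagrange_basis:
  assumes "i \<le> n"
  shows "degree (lagrange_basis n x i) \<le> n"
proof -
  have "degree (lagrange_basis n x i) \<le> (\<Sum>j\<in>{..n} - {i}. degree (smult (1 / (x i - x j)) [:- x j, 1:]))"
    unfolding lagrange_basis_def by (rule order.trans[OF degree_prod_sum_le]) auto
  also have "\<dots> \<le> (\<Sum>j\<in>{..n} - {i}. 1)" by (intro sum_mono) simp
  also have "\<dots> = n" using assms by simp
  finally show ?thesis .
qed

lemma lagrange_interpolation:
  assumes "inj_on x {..n}" and "degree p \<le> n"
  shows "(\<Sum>i\<le>n. smult (poly p (x i)) (lagrange_basis n x i)) = p"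
proof (rule poly_eqI_degree)
  let ?q = "\<Sum>i\<le>n. smult (poly p (x i)) (lagrange_basis n x i)"
  fix y assume "y \<in> x ` {..n}"
  then obtain j where "j \<le> n" "y = x j" by auto
  then show "poly ?q y = poly p y"
    using assms(1) by (simp add: poly_sum poly_lagrange_basis if_distrib[of "(*) _"] cong: if_cong)
next
  show "card (x ` {..n}) > degree (\<Sum>i\<le>n. smult (poly p (x i)) (lagrange_basis n x i))"
    using assms(1) by (auto simp: card_image less_Suc_eq_le intro!: degree_sum_le degree_lagrange_basis
        order.trans[OF degree_smult_le])
  show "card (x ` {..n}) > degree p" using assms by (simp add: card_image)
qed

text \<open>A solution \<open>b\<close> of the moment equations integrates every polynomial of degree at most \<open>n\<close>
  correctly, and integrating the basis polynomial of the point \<open>x i\<close> singles out \<open>b i\<close>.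
  Conversely, these values solve the system because interpolation reproduces \<open>X\<^sup>k\<close>
  coefficient by coefficient. The formula shows that the solution exists, is unique and depends
  continuously on the right-hand side.\<close>

lemma vandermonde_system_iff:
  fixes x b m :: "nat \<Rightarrow> 'a::field"
  assumes "inj_on x {..n}"
  shows "(\<forall>k\<le>n. (\<Sum>i\<le>n. b i * x i ^ k) = m k) \<longleftrightarrow>
         (\<forall>i\<le>n. b i = (\<Sum>k\<le>n. coeff (lagrange_basis n x i) k * m k))"
proof (intro iffI allI impI)
  fix i assume m: "\<forall>k\<le>n. (\<Sum>i\<le>n. b i * x i ^ k) = m k" and "i \<le> n"
  let ?l = "lagrange_basis n x i"
  have "(\<Sum>k\<le>n. coeff ?l k * m k) = (\<Sum>k\<le>n. coeff ?l k * (\<Sum>j\<le>n. b j * x j ^ k))"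
    using m by simp
  also have "\<dots> = (\<Sum>j\<le>n. b j * (\<Sum>k\<le>n. coeff ?l k * x j ^ k))"
    by (simp add: sum_distrib_left mult_ac) (rule sum.swap)
  also have "\<dots> = (\<Sum>j\<le>n. b j * poly ?l (x j))"
  proof -
    have "(\<Sum>k\<le>n. coeff ?l k * y ^ k) = poly ?l y" for y
      unfolding poly_altdef using degree_lagrange_basis[OF \<open>i \<le> n\<close>, of x]
      by (intro sum.mono_neutral_right) (auto simp: coeff_eq_0 not_le)
    then show ?thesis by simp
  qed
  also have "\<dots> = b i"
    using assms \<open>i \<le> n\<close> by (simp add: poly_lagrange_basis if_distrib[of "(*) _"] cong: if_cong)
  finally show "b i = (\<Sum>k\<le>n. coeff ?l k * m k)" by simp
next
  fix k assume b: "\<forall>i\<le>n. b i = (\<Sum>k\<le>n. coeff (lagrange_basis n x i) k * m k)" and "k \<le> n"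
  have "(\<Sum>i\<le>n. b i * x i ^ k) = (\<Sum>i\<le>n. (\<Sum>j\<le>n. coeff (lagrange_basis n x i) j * m j) * x i ^ k)"
    using b by simp
  also have "\<dots> = (\<Sum>j\<le>n. m j * (\<Sum>i\<le>n. x i ^ k * coeff (lagrange_basis n x i) j))"
    by (simp add: sum_distrib_left sum_distrib_right mult_ac) (rule sum.swap)
  also have "\<dots> = (\<Sum>j\<le>n. m j * coeff (monom 1 k) j)"
    using lagrange_interpolation[OF assms, of "monom 1 k"] \<open>k \<le> n\<close>
    by (simp add: degree_monom_eq poly_monom flip: coeff_sum coeff_smult)
  also have "\<dots> = m k"
    using \<open>k \<le> n\<close> by (simp add: if_distrib[of "(*) _"] cong: if_cong)
  finally show "(\<Sum>i\<le>n. b i * x i ^ k) = m k" .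
qed

section \<open>Sums of measures and discrete measures\<close>

definition add_measure :: "'a measure \<Rightarrow> 'a measure \<Rightarrow> 'a measure" where
  "add_measure M N = measure_of (space M) (sets M) (\<lambda>A. emeasure M A + emeasure N A)"

lemma sets_add_measure [simp]: "sets (add_measure M N) = sets M"
  by (simp add: add_measure_def)

lemma space_add_measure [simp]: "space (add_measure M N) = space M"
  by (simp add: add_measure_def)

lemma emeasure_add_measure:
  assumes "sets N = sets M" and "A \<in> sets M"
  shows "emeasure (add_measure M N) A = emeasure M A + emeasure N A"
  unfolding add_measure_def
proof (rule emeasure_measure_of_sigma)
  show "countably_additive (sets M) (\<lambda>A. emeasure M A + emeasure N A)"
  proof (rule countably_additiveI)
    fix F :: "nat \<Rightarrow> 'a set"
    assume "range F \<subseteq> sets M" "disjoint_family F" "\<Union>(range F) \<in> sets M"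
    then show "(\<Sum>i. emeasure M (F i) + emeasure N (F i)) = emeasure M (\<Union>(range F)) + emeasure N (\<Union>(range F))"
      using assms by (subst suminf_add[symmetric]) (auto simp: suminf_emeasure)
  qed
qed (use assms in \<open>auto simp: positive_def sets.sigma_algebra_axioms\<close>)

lemma nn_integral_add_measure:
  assumes sets_eq: "sets N = sets M" and "f \<in> borel_measurable M"
  shows "(\<integral>\<^sup>+y. f y \<partial>add_measure M N) = (\<integral>\<^sup>+y. f y \<partial>M) + (\<integral>\<^sup>+y. f y \<partial>N)"
  using assms(2)
proof (induction rule: borel_measurable_induct)
  case (cong f g)
  moreover have "space N = space M" using sets_eq by (rule sets_eq_imp_space_eq)
  ultimately show ?case by (simp cong: nn_integral_cong_simp)
next
  case (set A)
  then show ?case by (simp add: emeasure_add_measure sets_eq)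
next
  case (mult u c)
  note [measurable_cong] = sets_eq sets_add_measure[of M N]
  show ?case using mult by (simp add: nn_integral_cmult distrib_left)
next
  case (add u v)
  note [measurable_cong] = sets_eq sets_add_measure[of M N]
  show ?case using add by (simp add: nn_integral_add ac_simps)
next
  case (seq U)
  note [measurable_cong] = sets_eq sets_add_measure[of M N]
  have mono: "incseq (\<lambda>i. integral\<^sup>N K (U i))" for K
    using \<open>incseq U\<close> by (auto simp: incseq_def le_fun_def intro!: nn_integral_mono)
  have "(SUP i. integral\<^sup>N M (U i) + integral\<^sup>N N (U i))
      = (SUP i. integral\<^sup>N M (U i)) + (SUP i. integral\<^sup>N N (U i))"
    by (rule ennreal_SUP_add) (rule mono)+
  with seq show ?case by (simp add: nn_integral_monotone_convergence_SUP image_comp)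
qed

lemma
  fixes f :: "'a \<Rightarrow> real"
  assumes sets_eq: "sets N = sets M" and M: "integrable M f" and N: "integrable N f"
  shows integrable_add_measure: "integrable (add_measure M N) f"
    and integral_add_measure: "(LINT y|add_measure M N. f y) = (LINT y|M. f y) + (LINT y|N. f y)"
proof -
  have f: "f \<in> borel_measurable M" using M by simp
  have f': "f \<in> borel_measurable (add_measure M N)"
    using f by (simp cong: measurable_cong_sets)
  show "integrable (add_measure M N) f"
    using M N f f' sets_eq by (simp add: integrable_iff_bounded nn_integral_add_measure)
  moreover have fin: "(\<integral>\<^sup>+y. ennreal (f y) \<partial>K) < \<top>" "(\<integral>\<^sup>+y. ennreal (- f y) \<partial>K) < \<top>" if "integrable K f" for K
    using that by (auto simp: real_integrable_def less_top)
  ultimately show "(LINT y|add_measure M N. f y) = (LINT y|M. f y) + (LINT y|N. f y)"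
    using M N f fin[OF M] fin[OF N]
    by (simp add: real_lebesgue_integral_def nn_integral_add_measure[OF sets_eq] enn2real_plus)
qed

lemma sets_discrete_measure [simp, measurable_cong]: "sets (discrete_measure n w p) = sets borel"
  by (simp add: discrete_measure_def)

lemma nn_integral_discrete_measure:
  assumes "f \<in> borel_measurable borel"
  shows "(\<integral>\<^sup>+y. f y \<partial>discrete_measure n w p) = (\<Sum>i\<le>n. ennreal (w i) * f (p i))"
  using assms by (simp add: discrete_measure_def nn_integral_distr nn_integral_point_measure_finite)

lemma emeasure_discrete_measure:
  assumes "A \<in> sets borel"
  shows "emeasure (discrete_measure n w p) A = (\<Sum>i\<le>n. ennreal (w i) * indicator A (p i))"
  using nn_integral_discrete_measure[of "indicator A" n w p] assms by simp

lemma
  fixes f :: "real \<Rightarrow> real"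
  assumes "f \<in> borel_measurable borel" and "\<And>i. i \<le> n \<Longrightarrow> 0 \<le> w i"
  shows integrable_discrete_measure: "integrable (discrete_measure n w p) f"
    and integral_discrete_measure: "(LINT y|discrete_measure n w p. f y) = (\<Sum>i\<le>n. w i * f (p i))"
proof -
  show "integrable (discrete_measure n w p) f"
    using assms by (simp add: discrete_measure_def integrable_distr_eq integrable_point_measure_finite)
  show "(LINT y|discrete_measure n w p. f y) = (\<Sum>i\<le>n. w i * f (p i))"
    using lebesgue_integral_point_measure_finite[of "{..n}" w "\<lambda>i. f (p i)"] assms
    by (simp add: discrete_measure_def integral_distr)
qed

lemma sum_weights_prob_discrete_measure:
  assumes "prob_space (discrete_measure n w p)" and "\<forall>i\<le>n. 0 < w i"
  shows "(\<Sum>i\<le>n. w i) = 1"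
proof -
  interpret prob_space "discrete_measure n w p" by fact
  have "ennreal (\<Sum>i\<le>n. w i) = emeasure (discrete_measure n w p) UNIV"
  proof -
    have "(\<Sum>i\<le>n. ennreal (w i)) = ennreal (\<Sum>i\<le>n. w i)"
      by (rule sum_ennreal) (use assms(2) in \<open>auto intro: less_imp_le\<close>)
    then show ?thesis by (simp add: emeasure_discrete_measure)
  qed
  also have "\<dots> = 1"
    using emeasure_space_1 sets_eq_imp_space_eq[OF sets_discrete_measure, of n w p] by simp
  finally show ?thesis by simp
qed

section \<open>Bounding integrals against the total variation\<close>

text \<open>Additivity of the dominating measure \<open>M\<close> turns the setwise bound into one that holds for
  every partition at once.\<close>

lemma total_variation_le_emeasure:
  assumes "sets M = sets borel" and "\<And>B. B \<in> sets borel \<Longrightarrow> e2ennreal \<bar>\<mu> B\<bar> \<le> emeasure M B"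
  shows "total_variation \<mu> A \<le> emeasure M A"
  unfolding total_variation_def
proof (rule SUP_least)
  fix P assume P: "P \<in> {P. finite P \<and> disjoint P \<and> P \<subseteq> sets borel \<and> \<Union>P = A}"
  then have "(\<Sum>B\<in>P. e2ennreal \<bar>\<mu> B\<bar>) \<le> (\<Sum>B\<in>P. emeasure M B)"
    by (intro sum_mono assms(2)) auto
  also have "\<dots> = emeasure M (\<Union>B\<in>P. B)"
    using P by (intro sum_emeasure) (auto simp: assms(1) disjoint_def disjoint_family_on_def)
  finally show "(\<Sum>B\<in>P. e2ennreal \<bar>\<mu> B\<bar>) \<le> emeasure M A" using P by simp
qed

text \<open>A set function that fails to be a measure generates the zero measure, so an upper bound on
  integrals against \<open>tv_measure \<mu>\<close> follows from an upper bound on \<open>total_variation \<mu>\<close> alone,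
  without showing that the total variation is countably additive.\<close>

lemma nn_integral_tv_measure_le:
  assumes "sets M = sets borel" and "\<And>B. B \<in> sets borel \<Longrightarrow> e2ennreal \<bar>\<mu> B\<bar> \<le> emeasure M B"
  shows "(\<integral>\<^sup>+y. f y \<partial>tv_measure \<mu>) \<le> (\<integral>\<^sup>+y. f y \<partial>M)"
proof (rule nn_integral_mono_measure)
  have closed: "sigma_sets UNIV (sets borel) = (sets borel :: real set set)"
    using sets.sigma_sets_eq[of "borel :: real measure"] by simp
  then show sets_eq: "sets (tv_measure \<mu>) = sets M"
    by (simp add: tv_measure_def sets_measure_of assms)
  have "emeasure (tv_measure \<mu>) A \<le> emeasure M A" for A
    unfolding tv_measure_def
    by (simp add: emeasure_measure_of_conv total_variation_le_emeasure[OF assms])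
  then show "tv_measure \<mu> \<le> M"
    by (simp add: le_measure[OF sets_eq])
qed

section \<open>The moments of the limiting distribution\<close>

lemma has_bochner_integral_powr_from_0:
  fixes a :: real
  assumes "a > -1"
  shows "has_bochner_integral lborel (\<lambda>t. indicator {0..1} t * t powr a) (1 / (a + 1))"
proof (rule has_bochner_integral_nn_integral)
  show "(\<integral>\<^sup>+t. ennreal (indicator {0..1} t * t powr a) \<partial>lborel) = ennreal (1 / (a + 1))"
    using nn_integral_powr_from_0[OF assms, of 1]
    by (simp add: ennreal_mult' ennreal_indicator mult.commute)
qed (use assms in auto)

text \<open>The value is the moment of order \<open>k + 2\<close> on \<open>\<bar>y\<bar> \<le> 1\<close> of the measure with tails
  \<open>cp t\<^sup>-\<^sup>\<alpha>\<close> and \<open>cm t\<^sup>-\<^sup>\<alpha>\<close>, divided by its second moment there, for \<open>\<alpha> > 0\<close>.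
  Requiring \<open>k \<ge> 1\<close> makes the integrand vanish at 0, where both half-lines contribute to the
  density.\<close>

lemma integral_power_mu_star:
  assumes "cp \<ge> 0" and "cm \<ge> 0" and "cp + cm > 0" and "\<alpha> < 2" and "k \<ge> 1"
  shows "(LINT y|mu_star \<alpha> cp cm. y ^ k)
    = (2 - \<alpha>) * (cp + (- 1) ^ k * cm) / ((real k + 2 - \<alpha>) * (cp + cm))"
proof -
  define b where "b = real k + 1 - \<alpha>"
  have "b > -1" using assms by (simp add: b_def)
  let ?h = "\<lambda>t::real. indicator {0..1} t * t powr b"
  have h: "has_bochner_integral lborel ?h (1 / (b + 1))"
    by (rule has_bochner_integral_powr_from_0) fact
  have h': "has_bochner_integral lborel (\<lambda>t. ?h (- t)) (1 / (b + 1))"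
    using lborel_has_bochner_integral_real_affine_iff[of "-1" ?h "1 / (b + 1)" 0] h by simp
  have pos: "y powr (1 - \<alpha>) * y ^ k = y powr b" if "y \<ge> 0" for y
    using that \<open>k \<ge> 1\<close> by (cases "y = 0") (auto simp: b_def powr_realpow[symmetric] powr_add[symmetric] algebra_simps)
  have neg: "(- y) powr (1 - \<alpha>) * y ^ k = (- 1) ^ k * (- y) powr b" if "y \<le> 0" for y
  proof -
    have "y ^ k = (- 1) ^ k * (- y) ^ k" by (simp flip: power_mult_distrib)
    then show ?thesis using pos[of "- y"] that by simp
  qed
  have density_eq: "(2 - \<alpha>) * \<bar>y\<bar> powr (1 - \<alpha>) * (cp * indicator {0..1} y + cm * indicator {-1..0} y) / (cp + cm) * y ^ k
      = (2 - \<alpha>) / (cp + cm) * (cp * ?h y + (- 1) ^ k * cm * ?h (- y))" for y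
  proof -
    have "\<bar>y\<bar> powr (1 - \<alpha>) * y ^ k * (cp * indicator {0..1} y + cm * indicator {-1..0} y)
        = cp * ?h y + (- 1) ^ k * cm * ?h (- y)" (is "?l = ?r")
      using pos[of y] neg[of y] \<open>k \<ge> 1\<close> by (cases "y = 0") (auto simp: indicator_def)
    moreover have "(2 - \<alpha>) * \<bar>y\<bar> powr (1 - \<alpha>) * (cp * indicator {0..1} y + cm * indicator {-1..0} y) / (cp + cm) * y ^ k
        = (2 - \<alpha>) / (cp + cm) * ?l"
      by (simp add: mult_ac)
    ultimately show ?thesis by simp
  qed
  have "(LINT y|mu_star \<alpha> cp cm. y ^ k) = (LINT y|lborel.
      (2 - \<alpha>) * \<bar>y\<bar> powr (1 - \<alpha>) * (cp * indicator {0..1} y + cm * indicator {-1..0} y) / (cp + cm) * y ^ k)"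
    unfolding mu_star_def using assms by (subst integral_density) (auto simp: indicator_def)
  also have "\<dots> = (LINT y|lborel. (2 - \<alpha>) / (cp + cm) * (cp * ?h y + (- 1) ^ k * cm * ?h (- y)))"
    unfolding density_eq ..
  also have "\<dots> = (2 - \<alpha>) / (cp + cm) * (cp * (1 / (b + 1)) + (- 1) ^ k * cm * (1 / (b + 1)))"
    by (intro has_bochner_integral_integral_eq has_bochner_integral_mult_right has_bochner_integral_add h h')
  also have "\<dots> = (2 - \<alpha>) / (cp + cm) * ((cp + (- 1) ^ k * cm) / (b + 1))"
    by (simp add: add_divide_distrib)
  also have "b + 1 = real k + 2 - \<alpha>" by (simp add: b_def)
  finally show ?thesis by (simp add: mult.commute)
qed

section \<open>The high-order scheme\<close>

lemma sigma2_nonneg: "0 \<le> sigma2 \<nu> \<epsilon>"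
  unfolding sigma2_def set_lebesgue_integral_def by (intro integral_nonneg_AE) (auto simp: indicator_def)

lemma
  assumes inj: "inj_on x {..n}" and "sigma2 \<nu> \<epsilon> \<noteq> 0" and "\<epsilon> \<noteq> 0"
  shows scheme_coeff_eq: "i \<le> n \<Longrightarrow> scheme_coeff \<nu> n x \<epsilon> i = (\<Sum>k\<le>n. coeff (lagrange_basis n x i) k *
      ((LINT y:{y. \<bar>y\<bar> \<le> \<epsilon>}|\<nu>. y ^ (2 + k)) / (sigma2 \<nu> \<epsilon> * \<epsilon> ^ k)))"
    and solves_scheme_coeff: "solves_scheme_system \<nu> n x \<epsilon> (scheme_coeff \<nu> n x \<epsilon>)"
proof -
  let ?m = "\<lambda>k. (LINT y:{y. \<bar>y\<bar> \<le> \<epsilon>}|\<nu>. y ^ (2 + k)) / (sigma2 \<nu> \<epsilon> * \<epsilon> ^ k)"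
  let ?b = "\<lambda>i. \<Sum>k\<le>n. coeff (lagrange_basis n x i) k * ?m k"
  have solves: "solves_scheme_system \<nu> n x \<epsilon> a \<longleftrightarrow> (\<forall>i\<le>n. a i = ?b i)" for a
  proof -
    have "solves_scheme_system \<nu> n x \<epsilon> a \<longleftrightarrow> (\<forall>k\<le>n. (\<Sum>i\<le>n. a i * x i ^ k) = ?m k)"
      unfolding solves_scheme_system_def sum_distrib_right[symmetric]
      using assms by (simp add: eq_divide_eq mult_ac)
    then show ?thesis by (simp add: vandermonde_system_iff[OF inj])
  qed
  have "scheme_coeff \<nu> n x \<epsilon> = (\<lambda>i. if i \<le> n then ?b i else 0)"
    unfolding scheme_coeff_def solves by (rule the_equality) (auto simp: fun_eq_iff)
  then show "i \<le> n \<Longrightarrow> scheme_coeff \<nu> n x \<epsilon> i = ?b i"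
    and "solves_scheme_system \<nu> n x \<epsilon> (scheme_coeff \<nu> n x \<epsilon>)"
    by (simp_all add: solves)
qed

text \<open>The mass that the scheme puts on the point \<open>\<epsilon> * x i\<close>.\<close>

definition scheme_weight where
  "scheme_weight \<nu> n x \<epsilon> i = sigma2 \<nu> \<epsilon> * scheme_coeff \<nu> n x \<epsilon> i / ((x i)\<^sup>2 * \<epsilon>\<^sup>2)"

lemma nu_eps_eq:
  "nu_eps \<nu> n x \<epsilon> A = measure \<nu> (A \<inter> {y. \<bar>y\<bar> > \<epsilon>}) + (\<Sum>i\<le>n. scheme_weight \<nu> n x \<epsilon> i * indicator A (\<epsilon> * x i))"
  by (simp add: nu_eps_def scheme_weight_def sum_distrib_left mult_ac)

lemma scheme_weight_power:
  assumes "\<epsilon> > 0" and "x i \<noteq> 0"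
  shows "scheme_weight \<nu> n x \<epsilon> i * (\<epsilon> * x i) ^ (2 + k)
       = sigma2 \<nu> \<epsilon> * (scheme_coeff \<nu> n x \<epsilon> i * x i ^ k * \<epsilon> ^ k)"
  using assms by (simp add: scheme_weight_def power_add power_mult_distrib power2_eq_square)

text \<open>The scheme as a measure instead of a set function. Negative weights are read as zero here, so
  this is \<open>nu_eps\<close> only when all weights are nonnegative.\<close>

definition scheme_measure where
  "scheme_measure \<nu> n x \<epsilon> = add_measure (density \<nu> (\<lambda>y. ennreal (indicator {y. \<bar>y\<bar> > \<epsilon>} y)))
     (discrete_measure n (scheme_weight \<nu> n x \<epsilon>) (\<lambda>i. \<epsilon> * x i))"

lemma emeasure_scheme_measure:
  assumes levy: "levy_measure \<nu>" and "\<epsilon> > 0" and w: "\<And>i. i \<le> n \<Longrightarrow> 0 \<le> scheme_weight \<nu> n x \<epsilon> i"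
    and A: "A \<in> sets borel"
  shows "emeasure (scheme_measure \<nu> n x \<epsilon>) A = ennreal (nu_eps \<nu> n x \<epsilon> A)"
proof -
  have [simp, measurable_cong]: "sets \<nu> = sets borel" using levy by (simp add: levy_measure_def)
  have fin: "emeasure \<nu> (A \<inter> {y. \<epsilon> < \<bar>y\<bar>}) = ennreal (measure \<nu> (A \<inter> {y. \<epsilon> < \<bar>y\<bar>}))"
    by (rule levy_measure_emeasure_away_from_0[OF levy \<open>\<epsilon> > 0\<close>]) auto
  have "emeasure (scheme_measure \<nu> n x \<epsilon>) A
      = emeasure \<nu> (A \<inter> {y. \<epsilon> < \<bar>y\<bar>}) + (\<Sum>i\<le>n. ennreal (scheme_weight \<nu> n x \<epsilon> i) * indicator A (\<epsilon> * x i))"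
    using A by (simp add: scheme_measure_def emeasure_add_measure ennreal_indicator emeasure_restricted
      emeasure_discrete_measure Int_commute)
  also have "(\<Sum>i\<le>n. ennreal (scheme_weight \<nu> n x \<epsilon> i) * indicator A (\<epsilon> * x i))
      = ennreal (\<Sum>i\<le>n. scheme_weight \<nu> n x \<epsilon> i * indicator A (\<epsilon> * x i))"
    using w by (subst sum_ennreal[symmetric]) (auto simp: ennreal_mult' ennreal_indicator)
  finally show ?thesis
    unfolding fin nu_eps_eq using w by (subst ennreal_plus) (auto intro!: sum_nonneg)
qed

lemma
  assumes levy: "levy_measure \<nu>" and "\<epsilon> > 0" and w: "\<And>i. i \<le> n \<Longrightarrow> 0 \<le> scheme_weight \<nu> n x \<epsilon> i"
  shows positive_borel_measure_nu_eps: "positive_borel_measure (nu_eps \<nu> n x \<epsilon>)"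
    and to_measure_nu_eps: "to_measure (nu_eps \<nu> n x \<epsilon>) = scheme_measure \<nu> n x \<epsilon>"
proof -
  let ?M = "scheme_measure \<nu> n x \<epsilon>"
  have sets_M: "sets ?M = sets borel" using levy by (simp add: scheme_measure_def levy_measure_def)
  then have space_M: "space ?M = UNIV" using sets_eq_imp_space_eq[of ?M borel] by simp
  have closed: "sigma_sets UNIV (sets borel) = (sets borel :: real set set)"
    using sets.sigma_sets_eq[of "borel :: real measure"] by simp
  note eq = emeasure_scheme_measure[OF assms]
  have "measure_space UNIV (sets borel) (\<lambda>A. ennreal (nu_eps \<nu> n x \<epsilon> A)) = measure_space UNIV (sets borel) (emeasure ?M)"
    using measure_space_eq[of "sets borel" UNIV "\<lambda>A. ennreal (nu_eps \<nu> n x \<epsilon> A)" "emeasure ?M"]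
    unfolding closed by (simp add: eq)
  also have "\<dots>" using measure_space[of ?M] by (simp add: sets_M space_M)
  finally show "positive_borel_measure (nu_eps \<nu> n x \<epsilon>)"
    unfolding positive_borel_measure_def using w by (auto simp: nu_eps_eq intro!: add_nonneg_nonneg sum_nonneg)
  have "to_measure (nu_eps \<nu> n x \<epsilon>) = measure_of UNIV (sets borel) (emeasure ?M)"
    unfolding to_measure_def by (rule measure_of_eq) (auto simp: closed eq)
  also have "\<dots> = ?M" using measure_of_of_measure[of ?M] by (simp add: sets_M space_M)
  finally show "to_measure (nu_eps \<nu> n x \<epsilon>) = ?M" .
qed

text \<open>The scheme leaves \<open>\<nu>\<close> unchanged on \<open>\<bar>y\<bar> > \<epsilon>\<close>. Since the atoms carry the weight
  \<open>1 / (\<epsilon> x i)\<^sup>2\<close>, their moment of order \<open>2 + j\<close> is the left-hand side of the \<open>j\<close>-th equation of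
  the linear system, whose right-hand side is the moment of order \<open>2 + j\<close> of \<open>\<nu>\<close> on
  \<open>\<bar>y\<bar> \<le> \<epsilon>\<close>.\<close>

lemma scheme_measure_moments:
  assumes levy: "levy_measure \<nu>" and "\<epsilon> > 0" and w: "\<And>i. i \<le> n \<Longrightarrow> 0 \<le> scheme_weight \<nu> n x \<epsilon> i"
    and x: "\<forall>i\<le>n. x i \<noteq> 0" and solves: "solves_scheme_system \<nu> n x \<epsilon> (scheme_coeff \<nu> n x \<epsilon>)"
    and k: "2 \<le> k" "k \<le> n + 2" and fin: "(\<integral>\<^sup>+y. ennreal (\<bar>y\<bar> ^ k) \<partial>\<nu>) < \<infinity>"
  shows "integrable (scheme_measure \<nu> n x \<epsilon>) (\<lambda>y. y ^ k)
    \<and> (LINT y|\<nu>. y ^ k) = (LINT y|scheme_measure \<nu> n x \<epsilon>. y ^ k)"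
proof -
  have [simp, measurable_cong]: "sets \<nu> = sets borel" using levy by (simp add: levy_measure_def)
  let ?big = "{y. \<epsilon> < \<bar>y\<bar>}"
  let ?N = "density \<nu> (\<lambda>y. ennreal (indicator ?big y))"
  let ?D = "discrete_measure n (scheme_weight \<nu> n x \<epsilon>) (\<lambda>i. \<epsilon> * x i)"
  have int: "integrable \<nu> (\<lambda>y. y ^ k)"
    using fin by (intro integrableI_bounded) (auto simp: power_abs)
  have N: "integrable ?N (\<lambda>y. y ^ k)" "(LINT y|?N. y ^ k) = (LINT y:?big|\<nu>. y ^ k)"
    using integrable_mult_indicator[OF _ int, of ?big]
    by (simp_all add: integrable_density integral_density set_lebesgue_integral_def)
  have D: "integrable ?D (\<lambda>y. y ^ k)" "(LINT y|?D. y ^ k) = (\<Sum>i\<le>n. scheme_weight \<nu> n x \<epsilon> i * (\<epsilon> * x i) ^ k)"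
    by (intro integrable_discrete_measure integral_discrete_measure w; simp)+
  obtain j where j: "k = 2 + j" "j \<le> n" using k by (metis add.commute add_le_cancel_right le_Suc_ex)
  have "(\<Sum>i\<le>n. scheme_weight \<nu> n x \<epsilon> i * (\<epsilon> * x i) ^ k)
      = sigma2 \<nu> \<epsilon> * (\<Sum>i\<le>n. scheme_coeff \<nu> n x \<epsilon> i * x i ^ j * \<epsilon> ^ j)"
    unfolding j(1) sum_distrib_left using \<open>\<epsilon> > 0\<close> x by (intro sum.cong scheme_weight_power) auto
  also have "\<dots> = (LINT y:{y. \<bar>y\<bar> \<le> \<epsilon>}|\<nu>. y ^ k)"
    using solves j by (simp add: solves_scheme_system_def)
  finally have D': "(LINT y|?D. y ^ k) = (LINT y:{y. \<bar>y\<bar> \<le> \<epsilon>}|\<nu>. y ^ k)" using D by simp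
  have "(LINT y|\<nu>. y ^ k) = (LINT y:?big \<union> {y. \<bar>y\<bar> \<le> \<epsilon>}|\<nu>. y ^ k)"
    unfolding set_lebesgue_integral_def by (intro Bochner_Integration.integral_cong) (auto simp: indicator_def)
  also have "\<dots> = (LINT y:?big|\<nu>. y ^ k) + (LINT y:{y. \<bar>y\<bar> \<le> \<epsilon>}|\<nu>. y ^ k)"
    using integrable_mult_indicator[OF _ int] by (intro set_integral_Un) (auto simp: set_integrable_def)
  finally show ?thesis
    unfolding scheme_measure_def using N D D' by (simp add: integrable_add_measure integral_add_measure)
qed

text \<open>The difference of \<open>\<nu>\<close> and the scheme is \<open>\<nu>\<close> on \<open>\<bar>y\<bar> \<le> \<epsilon>\<close> minus the atoms, hence
  dominated by the sum of the two with absolute weights. The common part on \<open>\<bar>y\<bar> > \<epsilon>\<close> is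
  finite, so it cancels even where \<open>\<nu>\<close> is infinite.\<close>

lemma abs_nu_diff_le:
  assumes levy: "levy_measure \<nu>" and "\<epsilon> > 0" and A: "A \<in> sets borel"
  shows "e2ennreal \<bar>nu_diff \<nu> n x \<epsilon> A\<bar>
    \<le> emeasure (add_measure (density \<nu> (indicator {y. \<bar>y\<bar> \<le> \<epsilon>}))
         (discrete_measure n (\<lambda>i. \<bar>scheme_weight \<nu> n x \<epsilon> i\<bar>) (\<lambda>i. \<epsilon> * x i))) A"
proof -
  have [simp, measurable_cong]: "sets \<nu> = sets borel" using levy by (simp add: levy_measure_def)
  let ?S = "emeasure \<nu> ({y. \<bar>y\<bar> \<le> \<epsilon>} \<inter> A)" and ?B = "A \<inter> {y. \<epsilon> < \<bar>y\<bar>}"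
  let ?w = "\<lambda>i. scheme_weight \<nu> n x \<epsilon> i * indicator A (\<epsilon> * x i)"
  have fin: "emeasure \<nu> ?B = ennreal (measure \<nu> ?B)"
    by (rule levy_measure_emeasure_away_from_0[OF levy \<open>\<epsilon> > 0\<close>]) auto
  have "emeasure \<nu> A = emeasure \<nu> (({y. \<bar>y\<bar> \<le> \<epsilon>} \<inter> A) \<union> ?B)"
    by (intro arg_cong[where f = "emeasure \<nu>"]) auto
  also have "\<dots> = ?S + ennreal (measure \<nu> ?B)"
    using A by (subst plus_emeasure[symmetric]) (auto simp: fin)
  finally have split: "emeasure \<nu> A = ?S + ennreal (measure \<nu> ?B)" .
  have "(\<Sum>i\<le>n. ennreal \<bar>scheme_weight \<nu> n x \<epsilon> i\<bar> * indicator A (\<epsilon> * x i)) = ennreal (\<Sum>i\<le>n. \<bar>?w i\<bar>)"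
    by (subst sum_ennreal[symmetric]) (auto simp: ennreal_mult' ennreal_indicator abs_mult)
  then have rhs: "emeasure (add_measure (density \<nu> (indicator {y. \<bar>y\<bar> \<le> \<epsilon>}))
         (discrete_measure n (\<lambda>i. \<bar>scheme_weight \<nu> n x \<epsilon> i\<bar>) (\<lambda>i. \<epsilon> * x i))) A
      = ?S + ennreal (\<Sum>i\<le>n. \<bar>?w i\<bar>)"
    using A by (simp add: emeasure_add_measure emeasure_restricted emeasure_discrete_measure)
  show ?thesis
  proof (cases ?S)
    case (real s)
    have "nu_diff \<nu> n x \<epsilon> A = ereal (s - (\<Sum>i\<le>n. ?w i))"
      unfolding nu_diff_def split real nu_eps_eq using \<open>0 \<le> s\<close>
      by (simp flip: ennreal_plus)
    moreover have "\<bar>s - (\<Sum>i\<le>n. ?w i)\<bar> \<le> s + (\<Sum>i\<le>n. \<bar>?w i\<bar>)"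
      using sum_abs[of ?w "{..n}"] \<open>0 \<le> s\<close> by linarith
    ultimately show ?thesis
      unfolding rhs real using \<open>0 \<le> s\<close> by (simp add: sum_nonneg ennreal_leI flip: ennreal_plus)
  next
    case top
    then show ?thesis unfolding rhs by simp
  qed
qed

text \<open>Both parts of the dominating measure live at distance of order \<open>\<epsilon>\<close> from the origin, so
  \<open>n + 1\<close> of the \<open>n + 3\<close> powers can be traded for \<open>\<epsilon>\<^sup>n\<^sup>+\<^sup>1\<close>; the second moment that
  remains is \<open>sigma2\<close> times a constant.\<close>

lemma nn_integral_tv_nu_diff_le:
  assumes levy: "levy_measure \<nu>" and "\<epsilon> > 0" and x: "\<forall>i\<le>n. x i \<noteq> 0"
  shows "(\<integral>\<^sup>+y. ennreal (\<bar>y\<bar> ^ (n + 3)) \<partial>tv_measure (nu_diff \<nu> n x \<epsilon>))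
    \<le> ennreal (\<epsilon> ^ (n + 1) * sigma2 \<nu> \<epsilon> * (1 + (\<Sum>i\<le>n. \<bar>scheme_coeff \<nu> n x \<epsilon> i\<bar> * \<bar>x i\<bar> ^ (n + 1))))"
proof -
  have [simp, measurable_cong]: "sets \<nu> = sets borel" using levy by (simp add: levy_measure_def)
  let ?f = "\<lambda>y::real. ennreal (\<bar>y\<bar> ^ (n + 3))"
  let ?D = "discrete_measure n (\<lambda>i. \<bar>scheme_weight \<nu> n x \<epsilon> i\<bar>) (\<lambda>i. \<epsilon> * x i)"
  have "(\<integral>\<^sup>+y. ?f y \<partial>tv_measure (nu_diff \<nu> n x \<epsilon>))
      \<le> (\<integral>\<^sup>+y. ?f y \<partial>add_measure (density \<nu> (indicator {y. \<bar>y\<bar> \<le> \<epsilon>})) ?D)"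
    by (intro nn_integral_tv_measure_le abs_nu_diff_le levy \<open>\<epsilon> > 0\<close>) auto
  also have "\<dots> = (\<integral>\<^sup>+y. indicator {y. \<bar>y\<bar> \<le> \<epsilon>} y * ?f y \<partial>\<nu>) + (\<integral>\<^sup>+y. ?f y \<partial>?D)"
    by (subst nn_integral_add_measure) (auto simp: nn_integral_density)
  also have "(\<integral>\<^sup>+y. indicator {y. \<bar>y\<bar> \<le> \<epsilon>} y * ?f y \<partial>\<nu>)
      \<le> (\<integral>\<^sup>+y. ennreal (\<epsilon> ^ (n + 1) * (indicator {y. \<bar>y\<bar> \<le> \<epsilon>} y * y\<^sup>2)) \<partial>\<nu>)"
  proof (intro nn_integral_mono)
    fix y :: real
    have "\<bar>y\<bar> ^ (n + 3) \<le> \<epsilon> ^ (n + 1) * y\<^sup>2" if "\<bar>y\<bar> \<le> \<epsilon>"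
    proof -
      have "\<bar>y\<bar> ^ (n + 3) = \<bar>y\<bar> ^ (n + 1) * \<bar>y\<bar>\<^sup>2"
        by (simp add: power_add power2_eq_square power3_eq_cube)
      also have "\<dots> \<le> \<epsilon> ^ (n + 1) * \<bar>y\<bar>\<^sup>2" using that by (intro mult_right_mono power_mono) auto
      finally show ?thesis by simp
    qed
    then show "indicator {y. \<bar>y\<bar> \<le> \<epsilon>} y * ?f y \<le> ennreal (\<epsilon> ^ (n + 1) * (indicator {y. \<bar>y\<bar> \<le> \<epsilon>} y * y\<^sup>2))"
      by (auto simp: indicator_def intro!: ennreal_leI)
  qed
  also have "\<dots> = ennreal (\<epsilon> ^ (n + 1) * sigma2 \<nu> \<epsilon>)"
  proof (subst nn_integral_eq_integral)
    show "integrable \<nu> (\<lambda>y. \<epsilon> ^ (n + 1) * (indicator {y. \<bar>y\<bar> \<le> \<epsilon>} y * y\<^sup>2))"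
      using levy_measure_power_integrable[OF levy, of 2 \<epsilon>] by (simp add: set_integrable_def)
  qed (use \<open>\<epsilon> > 0\<close> in \<open>auto simp: sigma2_def set_lebesgue_integral_def\<close>)
  also have "(\<integral>\<^sup>+y. ?f y \<partial>?D)
      = ennreal (\<epsilon> ^ (n + 1) * sigma2 \<nu> \<epsilon> * (\<Sum>i\<le>n. \<bar>scheme_coeff \<nu> n x \<epsilon> i\<bar> * \<bar>x i\<bar> ^ (n + 1)))"
  proof -
    have "\<bar>scheme_weight \<nu> n x \<epsilon> i\<bar> * \<bar>\<epsilon> * x i\<bar> ^ (n + 3)
        = \<epsilon> ^ (n + 1) * sigma2 \<nu> \<epsilon> * (\<bar>scheme_coeff \<nu> n x \<epsilon> i\<bar> * \<bar>x i\<bar> ^ (n + 1))" if "i \<le> n" for i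
      using arg_cong[OF scheme_weight_power[of \<epsilon> x i \<nu> n "n + 1"], of abs] \<open>\<epsilon> > 0\<close> x that sigma2_nonneg[of \<nu> \<epsilon>]
      by (simp add: abs_mult power_abs mult_ac numeral_3_eq_3)
    then have "(\<Sum>i\<le>n. \<bar>scheme_weight \<nu> n x \<epsilon> i\<bar> * \<bar>\<epsilon> * x i\<bar> ^ (n + 3))
        = \<epsilon> ^ (n + 1) * sigma2 \<nu> \<epsilon> * (\<Sum>i\<le>n. \<bar>scheme_coeff \<nu> n x \<epsilon> i\<bar> * \<bar>x i\<bar> ^ (n + 1))"
      unfolding sum_distrib_left by (intro sum.cong) auto
    moreover have "(\<integral>\<^sup>+y. ?f y \<partial>?D) = ennreal (\<Sum>i\<le>n. \<bar>scheme_weight \<nu> n x \<epsilon> i\<bar> * \<bar>\<epsilon> * x i\<bar> ^ (n + 3))"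
      by (subst nn_integral_discrete_measure) (simp_all flip: ennreal_mult)
    ultimately show ?thesis by simp
  qed
  finally show ?thesis
    using sigma2_nonneg[of \<nu> \<epsilon>] \<open>\<epsilon> > 0\<close>
    by (simp add: distrib_left sum_nonneg flip: ennreal_plus)
qed

text \<open>After division by \<open>\<epsilon>\<^sup>k\<close> and \<open>sigma2\<close> the right-hand sides of the linear system
  converge to the moments of \<open>mu_star \<alpha> cp cm\<close>: the powers of \<open>\<epsilon>\<close> in the two truncated moments
  cancel.\<close>

lemma scheme_normalised_moment_tendsto:
  assumes "levy_measure \<nu>" and "0 < \<alpha>" and "\<alpha> < 2" and "0 \<le> cp" and "0 \<le> cm" and "0 < cp + cm"
    and "((\<lambda>\<epsilon>. \<epsilon> powr \<alpha> * measure \<nu> {\<epsilon><..}) \<longlongrightarrow> cp) (at_right 0)"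
    and "((\<lambda>\<epsilon>. \<epsilon> powr \<alpha> * measure \<nu> {..<-\<epsilon>}) \<longlongrightarrow> cm) (at_right 0)"
  shows "((\<lambda>\<epsilon>. (LINT y:{y. \<bar>y\<bar> \<le> \<epsilon>}|\<nu>. y ^ (2 + k)) / (sigma2 \<nu> \<epsilon> * \<epsilon> ^ k))
    \<longlongrightarrow> (2 - \<alpha>) * (cp + (- 1) ^ k * cm) / ((real k + 2 - \<alpha>) * (cp + cm))) (at_right 0)"
proof -
  note lim = truncated_moment_tendsto[OF assms(1) _ assms(2-5) assms(7,8)]
  have "((\<lambda>\<epsilon>. (\<epsilon> powr (\<alpha> - real (2 + k)) * (LINT y:{y. \<bar>y\<bar> \<le> \<epsilon>}|\<nu>. y ^ (2 + k)))
        / (\<epsilon> powr (\<alpha> - real 2) * (LINT y:{y. \<bar>y\<bar> \<le> \<epsilon>}|\<nu>. y ^ 2)))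
      \<longlongrightarrow> ((cp + (- 1) ^ (2 + k) * cm) * \<alpha> / (real (2 + k) - \<alpha>)) / ((cp + (- 1) ^ 2 * cm) * \<alpha> / (real 2 - \<alpha>)))
      (at_right 0)"
    using assms by (intro tendsto_divide lim) auto
  moreover have "((cp + (- 1) ^ (2 + k) * cm) * \<alpha> / (real (2 + k) - \<alpha>)) / ((cp + (- 1) ^ 2 * cm) * \<alpha> / (real 2 - \<alpha>))
      = (2 - \<alpha>) * (cp + (- 1) ^ k * cm) / ((real k + 2 - \<alpha>) * (cp + cm))"
  proof -
    have "(N * \<alpha> / P) / (Q * \<alpha> / R) = R * N / (P * Q)" for N P Q R :: real
      using \<open>0 < \<alpha>\<close> by simp
    then show ?thesis by (simp add: add.commute)
  qed
  moreover have "\<forall>\<^sub>F \<epsilon> in at_right 0. (\<epsilon> powr (\<alpha> - real (2 + k)) * (LINT y:{y. \<bar>y\<bar> \<le> \<epsilon>}|\<nu>. y ^ (2 + k)))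
        / (\<epsilon> powr (\<alpha> - real 2) * (LINT y:{y. \<bar>y\<bar> \<le> \<epsilon>}|\<nu>. y ^ 2))
      = (LINT y:{y. \<bar>y\<bar> \<le> \<epsilon>}|\<nu>. y ^ (2 + k)) / (sigma2 \<nu> \<epsilon> * \<epsilon> ^ k)"
    unfolding eventually_at_right_field
  proof (intro exI[of _ 1] conjI allI impI)
    fix \<epsilon> :: real assume "0 < \<epsilon>"
    then have "\<epsilon> powr (\<alpha> - real 2) = \<epsilon> powr (\<alpha> - real (2 + k)) * \<epsilon> ^ k"
      by (simp add: powr_realpow[symmetric] powr_add[symmetric])
    then show "(\<epsilon> powr (\<alpha> - real (2 + k)) * (LINT y:{y. \<bar>y\<bar> \<le> \<epsilon>}|\<nu>. y ^ (2 + k)))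
        / (\<epsilon> powr (\<alpha> - real 2) * (LINT y:{y. \<bar>y\<bar> \<le> \<epsilon>}|\<nu>. y ^ 2))
      = (LINT y:{y. \<bar>y\<bar> \<le> \<epsilon>}|\<nu>. y ^ (2 + k)) / (sigma2 \<nu> \<epsilon> * \<epsilon> ^ k)"
      using \<open>0 < \<epsilon>\<close> by (simp only: sigma2_def mult.assoc mult_divide_mult_cancel_left powr_eq_0_iff) (simp add: mult_ac)
  qed simp
  ultimately show ?thesis by (simp only: tendsto_cong)
qed

section \<open>Positivity, moments, mass and error of the scheme\<close>

theorem proposition4:
  fixes n :: nat and \<nu> :: "real measure" and cp cm \<alpha> :: real
    and x a :: "nat \<Rightarrow> real"
  assumes "levy_measure \<nu>"
    and "cp \<ge> 0" and "cm \<ge> 0" and "cp + cm > 0"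
    and "0 < \<alpha>" and "\<alpha> < 2"
    and "((\<lambda>\<epsilon>. \<epsilon> powr \<alpha> * measure \<nu> {\<epsilon><..}) \<longlongrightarrow> cp) (at_right 0)"
    and "((\<lambda>\<epsilon>. \<epsilon> powr \<alpha> * measure \<nu> {..<-\<epsilon>}) \<longlongrightarrow> cm) (at_right 0)"
    and "strict_mono_on {..n} x"
    and "\<forall>i\<le>n. x i \<noteq> 0"
    and "\<forall>i\<le>n. a i > 0"
    and "prob_space (discrete_measure n a x)"
    and "\<forall>k\<in>{1..n}. (\<integral>y. y ^ k \<partial>discrete_measure n a x) = (\<integral>y. y ^ k \<partial>mu_star \<alpha> cp cm)"
  shows "(\<exists>\<epsilon>0>0. \<forall>\<epsilon>. 0 < \<epsilon> \<and> \<epsilon> < \<epsilon>0 \<longrightarrow>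
            positive_borel_measure (nu_eps \<nu> n x \<epsilon>) \<and>
            (\<forall>k. 2 \<le> k \<and> k \<le> n + 2 \<and> (\<integral>\<^sup>+y. ennreal (\<bar>y\<bar> ^ k) \<partial>\<nu>) < \<infinity> \<longrightarrow>
               integrable (to_measure (nu_eps \<nu> n x \<epsilon>)) (\<lambda>y. y ^ k) \<and>
               (\<integral>y. y ^ k \<partial>\<nu>) = (\<integral>y. y ^ k \<partial>to_measure (nu_eps \<nu> n x \<epsilon>)))) \<and>
         (\<exists>C1>0. \<exists>C2>0.
            (\<lambda>\<epsilon>. nu_eps \<nu> n x \<epsilon> UNIV) \<sim>[at_right 0] (\<lambda>\<epsilon>. C1 * \<epsilon> powr (-\<alpha>)) \<and>
            Limsup (at_right 0)
              (\<lambda>\<epsilon>. (\<integral>\<^sup>+y. ennreal (\<bar>y\<bar> ^ (n + 3)) \<partial>tv_measure (nu_diff \<nu> n x \<epsilon>))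
                   / ennreal (C2 * \<epsilon> powr (real n + 3 - \<alpha>))) \<le> 1)"
proof -
  note levy = assms(1) and x = assms(10) and a = assms(11)
  have inj: "inj_on x {..n}" using assms(9) by (rule strict_mono_on_imp_inj_on)
  have [simp, measurable_cong]: "sets \<nu> = sets borel" using levy by (simp add: levy_measure_def)
  \<comment> \<open>The moments of \<open>mu_star \<alpha> cp cm\<close>; the value at \<open>k = 0\<close> is 1, its total mass.\<close>
  define m where "m k = (2 - \<alpha>) * (cp + (- 1) ^ k * cm) / ((real k + 2 - \<alpha>) * (cp + cm))" for k :: nat
  have "(\<Sum>i\<le>n. a i * x i ^ k) = m k" if "k \<le> n" for k
  proof (cases "k = 0")
    case True
    then show ?thesis
      using sum_weights_prob_discrete_measure[OF assms(12) a] assms by (simp add: m_def)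
  next
    case False
    then have "(\<Sum>i\<le>n. a i * x i ^ k) = (LINT y|mu_star \<alpha> cp cm. y ^ k)"
      using assms(13) that integral_discrete_measure[of "\<lambda>y. y ^ k" n a x] a
      by (simp add: less_imp_le)
    then show ?thesis using False assms by (simp add: integral_power_mu_star m_def)
  qed
  then have a_eq: "\<forall>i\<le>n. a i = (\<Sum>k\<le>n. coeff (lagrange_basis n x i) k * m k)"
    using vandermonde_system_iff[OF inj] by blast
  define s where "s = (cp + cm) * \<alpha> / (2 - \<alpha>)"
  have "s > 0" using assms by (simp add: s_def)
  have sigma2_lim: "((\<lambda>\<epsilon>. \<epsilon> powr (\<alpha> - 2) * sigma2 \<nu> \<epsilon>) \<longlongrightarrow> s) (at_right 0)"
    using truncated_moment_tendsto[OF levy _ assms(5,6,2,3,7,8), of 2] by (simp add: sigma2_def s_def)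
  have pos: "\<forall>\<^sub>F \<epsilon> :: real in at_right 0. 0 < \<epsilon>"
    by (auto simp: eventually_at_right_field intro: exI[of _ 1])
  have sigma2_pos: "\<forall>\<^sub>F \<epsilon> in at_right 0. 0 < sigma2 \<nu> \<epsilon>"
    using order_tendstoD(1)[OF sigma2_lim \<open>s > 0\<close>] pos
    by eventually_elim (simp add: zero_less_mult_iff)
  have coeff_lim: "((\<lambda>\<epsilon>. scheme_coeff \<nu> n x \<epsilon> i) \<longlongrightarrow> a i) (at_right 0)" if "i \<le> n" for i
  proof -
    have "((\<lambda>\<epsilon>. \<Sum>k\<le>n. coeff (lagrange_basis n x i) k *
          ((LINT y:{y. \<bar>y\<bar> \<le> \<epsilon>}|\<nu>. y ^ (2 + k)) / (sigma2 \<nu> \<epsilon> * \<epsilon> ^ k))) \<longlongrightarrow> a i) (at_right 0)"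
      unfolding a_eq[rule_format, OF that] m_def
      by (intro tendsto_sum tendsto_mult tendsto_const
          scheme_normalised_moment_tendsto[OF levy assms(5,6,2,3,4,7,8)])
    moreover have "\<forall>\<^sub>F \<epsilon> in at_right 0. (\<Sum>k\<le>n. coeff (lagrange_basis n x i) k *
          ((LINT y:{y. \<bar>y\<bar> \<le> \<epsilon>}|\<nu>. y ^ (2 + k)) / (sigma2 \<nu> \<epsilon> * \<epsilon> ^ k))) = scheme_coeff \<nu> n x \<epsilon> i"
      using sigma2_pos pos by eventually_elim (simp add: scheme_coeff_eq[OF inj _ _ that])
    ultimately show ?thesis by (simp only: tendsto_cong)
  qed
  have coeff_pos: "\<forall>\<^sub>F \<epsilon> in at_right 0. \<forall>i\<in>{..n}. 0 < scheme_coeff \<nu> n x \<epsilon> i"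
    using a by (intro eventually_ball_finite ballI order_tendstoD(1)[OF coeff_lim]) auto

  have "\<forall>\<^sub>F \<epsilon> in at_right 0. positive_borel_measure (nu_eps \<nu> n x \<epsilon>) \<and>
      (\<forall>k. 2 \<le> k \<and> k \<le> n + 2 \<and> (\<integral>\<^sup>+y. ennreal (\<bar>y\<bar> ^ k) \<partial>\<nu>) < \<infinity> \<longrightarrow>
         integrable (to_measure (nu_eps \<nu> n x \<epsilon>)) (\<lambda>y. y ^ k) \<and>
         (\<integral>y. y ^ k \<partial>\<nu>) = (\<integral>y. y ^ k \<partial>to_measure (nu_eps \<nu> n x \<epsilon>)))"
    using pos sigma2_pos coeff_pos
  proof eventually_elim
    case (elim \<epsilon>)
    have w: "0 \<le> scheme_weight \<nu> n x \<epsilon> i" if "i \<le> n" for i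
      using elim that by (simp add: scheme_weight_def less_imp_le)
    have "solves_scheme_system \<nu> n x \<epsilon> (scheme_coeff \<nu> n x \<epsilon>)"
      using elim by (intro solves_scheme_coeff inj) auto
    moreover have "to_measure (nu_eps \<nu> n x \<epsilon>) = scheme_measure \<nu> n x \<epsilon>"
      by (rule to_measure_nu_eps[OF levy elim(1)]) (rule w)
    ultimately show ?case
      using positive_borel_measure_nu_eps[OF levy elim(1)] scheme_measure_moments[OF levy elim(1)] w x by simp
  qed
  then have positive_and_moments: "\<exists>\<epsilon>0>0. \<forall>\<epsilon>. 0 < \<epsilon> \<and> \<epsilon> < \<epsilon>0 \<longrightarrow>
            positive_borel_measure (nu_eps \<nu> n x \<epsilon>) \<and>
            (\<forall>k. 2 \<le> k \<and> k \<le> n + 2 \<and> (\<integral>\<^sup>+y. ennreal (\<bar>y\<bar> ^ k) \<partial>\<nu>) < \<infinity> \<longrightarrow>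
               integrable (to_measure (nu_eps \<nu> n x \<epsilon>)) (\<lambda>y. y ^ k) \<and>
               (\<integral>y. y ^ k \<partial>\<nu>) = (\<integral>y. y ^ k \<partial>to_measure (nu_eps \<nu> n x \<epsilon>)))"
    unfolding eventually_at_right_field by blast

  define C1 where "C1 = cp + cm + s * (\<Sum>i\<le>n. a i / (x i)\<^sup>2)"
  have "C1 > 0" unfolding C1_def
    using assms(4) \<open>s > 0\<close> a by (intro add_pos_nonneg[OF assms(4)] mult_nonneg_nonneg sum_nonneg) (auto simp: less_imp_le)
  have "((\<lambda>\<epsilon>. \<epsilon> powr \<alpha> * measure \<nu> {\<epsilon><..} + \<epsilon> powr \<alpha> * measure \<nu> {..<-\<epsilon>}
      + \<epsilon> powr (\<alpha> - 2) * sigma2 \<nu> \<epsilon> * (\<Sum>i\<le>n. scheme_coeff \<nu> n x \<epsilon> i / (x i)\<^sup>2)) \<longlongrightarrow> C1) (at_right 0)"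
    unfolding C1_def using x
    by (intro tendsto_add tendsto_mult tendsto_sum tendsto_divide tendsto_const sigma2_lim coeff_lim assms(7,8)) auto
  moreover have "\<forall>\<^sub>F \<epsilon> in at_right 0. \<epsilon> powr \<alpha> * measure \<nu> {\<epsilon><..} + \<epsilon> powr \<alpha> * measure \<nu> {..<-\<epsilon>}
      + \<epsilon> powr (\<alpha> - 2) * sigma2 \<nu> \<epsilon> * (\<Sum>i\<le>n. scheme_coeff \<nu> n x \<epsilon> i / (x i)\<^sup>2)
      = nu_eps \<nu> n x \<epsilon> UNIV / \<epsilon> powr (- \<alpha>)"
    using pos
  proof eventually_elim
    case (elim \<epsilon>)
    have "measure \<nu> {y. \<epsilon> < \<bar>y\<bar>} = measure \<nu> ({\<epsilon><..} \<union> {..<-\<epsilon>})"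
      using elim by (intro arg_cong[where f = "measure \<nu>"]) auto
    also have "\<dots> = measure \<nu> {\<epsilon><..} + measure \<nu> {..<-\<epsilon>}"
      using elim levy_measure_emeasure_away_from_0[OF levy elim, of "{\<epsilon><..}"]
        levy_measure_emeasure_away_from_0[OF levy elim, of "{..<-\<epsilon>}"]
      by (intro measure_Union) (auto simp: subset_iff)
    finally have tails: "measure \<nu> {y. \<epsilon> < \<bar>y\<bar>} = measure \<nu> {\<epsilon><..} + measure \<nu> {..<-\<epsilon>}" .
    define S where "S = (\<Sum>i\<le>n. scheme_coeff \<nu> n x \<epsilon> i / (x i)\<^sup>2)"
    have scale: "\<epsilon> powr (\<alpha> - 2) = \<epsilon> powr \<alpha> / \<epsilon>\<^sup>2"
      using elim by (simp add: powr_diff powr_realpow[of \<epsilon> 2, simplified])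
    have atoms: "sigma2 \<nu> \<epsilon> * (\<Sum>i\<le>n. scheme_coeff \<nu> n x \<epsilon> i * indicator UNIV (\<epsilon> * x i) / ((x i)\<^sup>2 * \<epsilon>\<^sup>2))
        = sigma2 \<nu> \<epsilon> * S / \<epsilon>\<^sup>2"
      unfolding S_def divide_divide_eq_left[symmetric] sum_divide_distrib[symmetric] by simp
    show ?case
      unfolding nu_eps_def atoms S_def[symmetric] scale
      using elim by (simp add: tails powr_minus field_simps)
  qed
  ultimately have "((\<lambda>\<epsilon>. nu_eps \<nu> n x \<epsilon> UNIV / \<epsilon> powr (- \<alpha>)) \<longlongrightarrow> C1) (at_right 0)"
    by (simp only: tendsto_cong)
  then have mass: "(\<lambda>\<epsilon>. nu_eps \<nu> n x \<epsilon> UNIV) \<sim>[at_right 0] (\<lambda>\<epsilon>. C1 * \<epsilon> powr (- \<alpha>))"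
    using \<open>C1 > 0\<close> by (intro asymp_equivI'_const) auto

  let ?bound = "\<lambda>\<epsilon>. \<epsilon> powr (\<alpha> - 2) * sigma2 \<nu> \<epsilon> * (1 + (\<Sum>i\<le>n. \<bar>scheme_coeff \<nu> n x \<epsilon> i\<bar> * \<bar>x i\<bar> ^ (n + 1)))"
  \<comment> \<open>The added 1 puts \<open>C2\<close> strictly above the limit of the bound, so the ratio is at most 1
    for all small \<open>\<epsilon>\<close>.\<close>
  define C2 where "C2 = s * (1 + (\<Sum>i\<le>n. \<bar>a i\<bar> * \<bar>x i\<bar> ^ (n + 1))) + 1"
  have "C2 > 0" unfolding C2_def
    using \<open>s > 0\<close> by (intro add_nonneg_pos add_nonneg_nonneg mult_nonneg_nonneg sum_nonneg) auto
  have "(?bound \<longlongrightarrow> s * (1 + (\<Sum>i\<le>n. \<bar>a i\<bar> * \<bar>x i\<bar> ^ (n + 1)))) (at_right 0)"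
    by (intro tendsto_intros sigma2_lim coeff_lim) auto
  from order_tendstoD(2)[OF this, of C2]
  have "\<forall>\<^sub>F \<epsilon> in at_right 0. ?bound \<epsilon> < C2" by (simp add: C2_def)
  with pos have "\<forall>\<^sub>F \<epsilon> in at_right 0. (\<integral>\<^sup>+y. ennreal (\<bar>y\<bar> ^ (n + 3)) \<partial>tv_measure (nu_diff \<nu> n x \<epsilon>))
      / ennreal (C2 * \<epsilon> powr (real n + 3 - \<alpha>)) \<le> 1"
  proof eventually_elim
    case (elim \<epsilon>)
    let ?D = "C2 * \<epsilon> powr (real n + 3 - \<alpha>)"
    have "\<epsilon> ^ (n + 1) = \<epsilon> powr (real n + 3 - \<alpha>) * \<epsilon> powr (\<alpha> - 2)"
      using powr_realpow[OF elim(1), of "n + 1"] by (simp add: powr_add[symmetric] add.commute)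
    then have "\<epsilon> ^ (n + 1) * sigma2 \<nu> \<epsilon> * (1 + (\<Sum>i\<le>n. \<bar>scheme_coeff \<nu> n x \<epsilon> i\<bar> * \<bar>x i\<bar> ^ (n + 1)))
        = ?bound \<epsilon> * \<epsilon> powr (real n + 3 - \<alpha>)"
      by (simp only: mult_ac)
    also have "\<dots> \<le> ?D" using elim by (intro mult_right_mono) auto
    finally have "(\<integral>\<^sup>+y. ennreal (\<bar>y\<bar> ^ (n + 3)) \<partial>tv_measure (nu_diff \<nu> n x \<epsilon>)) \<le> ennreal ?D"
      by (rule order.trans[OF nn_integral_tv_nu_diff_le[OF levy elim(1) x] ennreal_leI])
    then have "(\<integral>\<^sup>+y. ennreal (\<bar>y\<bar> ^ (n + 3)) \<partial>tv_measure (nu_diff \<nu> n x \<epsilon>)) / ennreal ?D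
        \<le> ennreal ?D / ennreal ?D"
      by (rule divide_right_mono_ennreal)
    also have "\<dots> = 1" using \<open>C2 > 0\<close> elim by (intro ennreal_divide_self) auto
    finally show ?case .
  qed
  then have "Limsup (at_right 0) (\<lambda>\<epsilon>. (\<integral>\<^sup>+y. ennreal (\<bar>y\<bar> ^ (n + 3)) \<partial>tv_measure (nu_diff \<nu> n x \<epsilon>))
      / ennreal (C2 * \<epsilon> powr (real n + 3 - \<alpha>))) \<le> 1"
    by (rule Limsup_bounded)
  with positive_and_moments mass \<open>C1 > 0\<close> \<open>C2 > 0\<close> show ?thesis by blast
qed

end
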